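(* Let $S$ be a solenoid and $K$ be a Knaster continuum. Then $K\times S$ has the fupcon property; that is, for every continuum $M\subseteq K\times S$ with $\pi_K(M)=K$ and $\pi_S(M)=S$, and for every open set $U\subseteq K\times S$ with $M\subseteq U$, there exists an open connected set $V$ with $M\subseteq V\subseteq U$.
   Context: A continuum is a nonempty compact connected metric space. A solenoid is a continuum homeomorphic to an inverse limit $\varprojlim\{\mathbb{S}^1, f_i\}$ of unit circles with bonding maps $f_i(z)=z^{n_i}$, each $n_i\geq 2$ an integer. A Knaster continuum is a continuum homeomorphic to an inverse limit of arcs $[0,1]$ with open surjective bonding maps. For a product $X\times Y$ of continua, $\pi_X,\pi_Y$ denote the coordinate projections. $X\times Y$ has the fupcon property if every subcontinuum $M\subseteq X\times Y$ with $\pi_X(M)=X$ and $\pi_Y(M)=Y$ has the property that for every open $U\supseteq M$ there is an open connected $V$ with $M\subseteq V\subseteq U$. *)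

theory Defs
  imports "HOL-Analysis.Analysis"
begin

definition inverse_limit :: "(nat \<Rightarrow> 'a topology) \<Rightarrow> (nat \<Rightarrow> 'a \<Rightarrow> 'a) \<Rightarrow> (nat \<Rightarrow> 'a) topology" where
  "inverse_limit X f = subtopology (product_topology X UNIV) {x. \<forall>i. x i = f i (x (Suc i))}"

definition unit_circle :: "complex topology" where
  "unit_circle = top_of_set (sphere 0 1)"

definition unit_interval :: "real topology" where
  "unit_interval = top_of_set {0..1}"

definition is_continuum :: "'a topology \<Rightarrow> bool" where
  "is_continuum X \<longleftrightarrow> topspace X \<noteq> {} \<and> compact_space X \<and> connected_space X \<and> metrizable_space X"

definition solenoid :: "'a topology \<Rightarrow> bool" where
  "solenoid X \<longleftrightarrow> is_continuum X \<and> (\<exists>n :: nat \<Rightarrow> nat. (\<forall>i. n i \<ge> 2) \<and>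
     X homeomorphic_space inverse_limit (\<lambda>_. unit_circle) (\<lambda>i z. z ^ n i))"

definition knaster_continuum :: "'a topology \<Rightarrow> bool" where
  "knaster_continuum X \<longleftrightarrow> is_continuum X \<and> (\<exists>f :: nat \<Rightarrow> real \<Rightarrow> real.
     (\<forall>i. continuous_map unit_interval unit_interval (f i)
          \<and> open_map unit_interval unit_interval (f i)
          \<and> f i ` {0..1} = {0..1}) \<and>
     X homeomorphic_space inverse_limit (\<lambda>_. unit_interval) f)"

definition fupcon :: "'a topology \<Rightarrow> 'b topology \<Rightarrow> bool" where
  "fupcon X Y \<longleftrightarrow> (\<forall>M. M \<subseteq> topspace (prod_topology X Y) \<and> M \<noteq> {}
      \<and> compactin (prod_topology X Y) M \<and> connectedin (prod_topology X Y) M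
      \<and> fst ` M = topspace X \<and> snd ` M = topspace Y \<longrightarrow>
      (\<forall>U. openin (prod_topology X Y) U \<and> M \<subseteq> U \<longrightarrow>
        (\<exists>V. openin (prod_topology X Y) V \<and> connectedin (prod_topology X Y) V \<and> M \<subseteq> V \<and> V \<subseteq> U)))"

end

theory Submission
  imports Defs
begin

text \<open>
  A thread of the inverse system with levels \<open>[0,1] \<times> S\<^sup>1\<close> is a point of \<open>K \<times> S\<close>. By compactness \<open>U\<close>
  contains the preimage of an open neighbourhood of the projection of \<open>M\<close> at some level. Unwrap the
  circle to pass to the strip \<open>[0,1] \<times> \<real>\<close>, and let \<open>G\<close> be a component of the unwrapped neighbourhood
  over \<open>M\<close>. Since \<open>M\<close> projects onto the circle at all later levels, \<open>G\<close> meets \<open>G + r\<close> for some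
  integer \<open>r > 0\<close>, and planarity (two crossing paths in a rectangle meet) improves this to
  \<open>G + 1 = G\<close>. Since \<open>M\<close> projects onto the interval, \<open>G\<close> reaches both sides of the strip.
  A connected periodic subset of the strip that reaches both sides has a preimage of the same kind
  under every bonding map: the power map only rescales it, and an open interval map reflects copies of it
  that are glued at the sides. Passing to the limit, the threads over \<open>G\<close> form an open
  connected set.
\<close>

section \<open>Open surjections of the unit interval\<close>

locale open_interval_map =
  fixes f :: "real \<Rightarrow> real"
  assumes cont: "continuous_on {0..1} f"
    and onto: "f ` {0..1} = {0..1}"
    and open_image: "openin (top_of_set {0..1}) U \<Longrightarrow> openin (top_of_set {0..1}) (f ` U)"
begin

lemma range01: "x \<in> {0..1} \<Longrightarrow> f x \<in> {0..1}"
  using onto by blast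

text \<open>Openness makes the image of \<open>N\<close> a neighbourhood of \<open>f y\<close> in
  the interval. Such a neighbourhood has values on both sides of \<open>f y\<close>, unless
  \<open>f y\<close> is an end of the interval.\<close>

lemma local_extremum:
  assumes N: "openin (top_of_set {0..1}) N" and y: "y \<in> N"
    and ext: "(\<forall>x\<in>N. f y \<le> f x) \<or> (\<forall>x\<in>N. f x \<le> f y)"
  shows "f y = 0 \<or> f y = 1"
proof (rule ccontr)
  assume "\<not> ?thesis"
  moreover have "f y \<in> {0..1}"
    using N y range01 openin_imp_subset by blast
  ultimately have fy: "0 < f y" "f y < 1" by auto
  have "openin (top_of_set {0..1}) (f ` N)" by (rule open_image[OF N])
  then obtain e where e: "e > 0" "ball (f y) e \<inter> {0..1} \<subseteq> f ` N"
    using y unfolding openin_contains_ball by (meson imageI)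
  \<comment> \<open>\<open>e/2\<close> keeps \<open>f y - d\<close> and \<open>f y + d\<close>
    inside the ball; the other two bounds keep them inside the unit interval.\<close>
  define d where "d = min (e/2) (min (f y) (1 - f y))"
  have d: "0 < d" "d < e" "d \<le> f y" "d \<le> 1 - f y"
    using e fy by (auto simp: d_def)
  then have "f y - d \<in> f ` N" "f y + d \<in> f ` N"
    using e by (auto simp: dist_real_def subset_iff)
  then show False using ext d by force
qed

lemma interior_extremum:
  assumes "0 \<le> x" "y \<le> 1" "w \<in> {x<..<y}"
    and "(\<forall>v\<in>{x<..<y}. f w \<le> f v) \<or> (\<forall>v\<in>{x<..<y}. f v \<le> f w)"
  shows "f w = 0 \<or> f w = 1"
proof (rule local_extremum)
  show "openin (top_of_set {0..1}) {x<..<y}"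
    using assms by (intro open_subset) auto
qed (use assms in auto)

text \<open>With equal end values, neither the maximum nor the minimum over \<open>{x..y}\<close>
  could lie inside. Both would be attained at the ends, so \<open>f\<close> would be constant and
  the midpoint an interior extremum.\<close>

lemma ends_differ:
  assumes xy: "0 \<le> x" "x < y" "y \<le> 1"
    and inside: "\<And>w. w \<in> {x<..<y} \<Longrightarrow> 0 < f w \<and> f w < 1"
  shows "f x \<noteq> f y"
proof
  assume eq: "f x = f y"
  have c: "continuous_on {x..y} f"
    using cont by (rule continuous_on_subset) (use xy in auto)
  obtain a where a: "a \<in> {x..y}" "\<forall>v\<in>{x..y}. f v \<le> f a"
    using continuous_attains_sup[OF _ _ c] xy by auto
  obtain b where b: "b \<in> {x..y}" "\<forall>v\<in>{x..y}. f b \<le> f v"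
    using continuous_attains_inf[OF _ _ c] xy by auto
  have *: False if "w \<in> {x<..<y}" "(\<forall>v\<in>{x<..<y}. f w \<le> f v) \<or> (\<forall>v\<in>{x<..<y}. f v \<le> f w)" for w
    using interior_extremum[OF xy(1) xy(3) that] inside[OF that(1)] by auto
  have "a \<notin> {x<..<y}" using *[of a] a(2) by fastforce
  moreover have "b \<notin> {x<..<y}" using *[of b] b(2) by fastforce
  ultimately have ab: "f a = f x" "f b = f x" using a(1) b(1) eq by force+
  have const: "f v = f x" if "v \<in> {x..y}" for v
    using a(2) b(2) that unfolding ab by (meson order_antisym)
  have "f ((x+y)/2) = f x" "(x+y)/2 \<in> {x<..<y}" using xy by (auto intro!: const)
  moreover have "f ((x+y)/2) \<le> f v" if "v \<in> {x<..<y}" for v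
    using const[of v] that \<open>f ((x+y)/2) = f x\<close> by simp
  ultimately show False using *[of "(x+y)/2"] by blast
qed

text \<open>Otherwise \<open>f e\<close> is no local extremum, so smaller and larger values occur
  near \<open>e\<close>, and all on one side of it. The intermediate value theorem then gives
  another point \<open>w\<close> with \<open>f w = f e\<close>, against
  \<open>ends_differ\<close>.\<close>

lemma end_values:
  assumes e: "e = 0 \<or> e = 1"
  shows "f e = 0 \<or> f e = 1"
proof (rule ccontr)
  assume ne: "\<not> ?thesis"
  have e01: "e \<in> {0..1}" using e by auto
  then have fe: "0 < f e" "f e < 1" using ne range01[of e] by auto
  have "openin (top_of_set {0..1}) ({0..1} \<inter> f -` {0<..<1})"
    using cont by (auto intro!: continuous_openin_preimage_gen)
  moreover have "e \<in> {0..1} \<inter> f -` {0<..<1}" using e01 fe by auto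
  ultimately obtain d where d: "d > 0" "ball e d \<inter> {0..1} \<subseteq> {0..1} \<inter> f -` {0<..<1}"
    unfolding openin_contains_ball by meson
  define N where "N = ball e d \<inter> {0..1}"
  have N: "openin (top_of_set {0..1}) N" "e \<in> N"
    using d e01 openin_open_Int[OF open_ball, of "{0..1}" e d] by (auto simp: N_def Int_commute)
  obtain y where y: "y \<in> N" "f y < f e"
    using local_extremum[OF N] ne by (meson linorder_not_le)
  obtain y' where y': "y' \<in> N" "f e < f y'"
    using local_extremum[OF N] ne by (meson linorder_not_le)
  have sub: "closed_segment u v \<subseteq> N" if "u \<in> N" "v \<in> N" for u v
  proof -
    have "convex N" unfolding N_def by (intro convex_Int) auto
    then show ?thesis using that by (simp add: closed_segment_subset)
  qed
  have "connected (f ` closed_segment y y')"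
    using y y' sub[of y y'] by (intro connected_continuous_image continuous_on_subset[OF cont]) (auto simp: N_def)
  then have "f e \<in> f ` closed_segment y y'"
    by (rule connectedD_interval[of _ "f y" "f y'"]) (use y y' in auto)
  then obtain w where w: "w \<in> closed_segment y y'" "f w = f e" by auto
  have yy: "y \<noteq> e" "y' \<noteq> e" using y y' by auto
  have "w \<in> N" using w sub y y' by blast
  \<comment> \<open>\<open>e\<close> is an end of the interval, so \<open>y\<close> and
    \<open>y'\<close> lie on the same side of it and the segment between them misses
    \<open>e\<close>.\<close>
  have we: "w \<noteq> e"
    using w yy e \<open>y \<in> N\<close> \<open>y' \<in> N\<close> by (auto simp: closed_segment_eq_real_ivl N_def split: if_splits)
  have sub2: "closed_segment e w \<subseteq> N" by (rule sub) (use N \<open>w \<in> N\<close> in auto)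
  have ins: "0 < f v \<and> f v < 1" if "v \<in> N" for v using that d by (auto simp: N_def)
  show False
  proof (cases "e < w")
    case True
    then show False using ends_differ[of e w] w sub2 ins \<open>w \<in> N\<close> e01
      by (auto simp: closed_segment_eq_real_ivl N_def subset_iff)
  next
    case False
    then show False using ends_differ[of w e] w sub2 ins \<open>w \<in> N\<close> e01 we
      by (auto simp: closed_segment_eq_real_ivl N_def subset_iff)
  qed
qed

text \<open>By uniform continuity, two such points closer than \<open>d\<close> have the same value,
  and every extremum between them has that value too. So \<open>f\<close> is constant there and maps
  an open interval to a single point, which is not open. Points that are \<open>d\<close> apart are
  finite in number.\<close>

lemma finite_turning_points: "finite {x \<in> {0..1}. f x = 0 \<or> f x = 1}" (is "finite ?Z")
proof -
  have "uniformly_continuous_on {0..1} f"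
    using cont by (simp add: compact_uniformly_continuous)
  then obtain d where d: "d > 0" "\<And>x y. x \<in> {0..1} \<Longrightarrow> y \<in> {0..1} \<Longrightarrow> dist x y < d \<Longrightarrow> dist (f x) (f y) < 1"
    unfolding uniformly_continuous_on_def by (metis zero_less_one)
  have sep: "d \<le> y - x" if "x \<in> ?Z" "y \<in> ?Z" "x < y" for x y
  proof (rule ccontr)
    assume "\<not> ?thesis"
    then have close: "dist (f u) (f v) < 1" if "u \<in> {x..y}" "v \<in> {x..y}" for u v
      using d(2)[of u v] \<open>x \<in> ?Z\<close> \<open>y \<in> ?Z\<close> that by (auto simp: dist_real_def)
    have c: "continuous_on {x..y} f"
      using cont by (rule continuous_on_subset) (use that in auto)
    have fxy: "f x = f y" using that close[of x y] by (auto simp: dist_real_def)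
    have nz: "\<not> (0 < f w \<and> f w < 1) \<Longrightarrow> f w = f x" if "w \<in> {x..y}" for w
      using close[of x w] that range01[of w] \<open>x \<in> ?Z\<close> \<open>y \<in> ?Z\<close> by (auto simp: dist_real_def)
    have xle: "x \<le> y" using that by auto
    obtain a where a: "a \<in> {x..y}" "\<forall>v\<in>{x..y}. f v \<le> f a"
      using continuous_attains_sup[OF _ _ c] xle by auto
    obtain b where b: "b \<in> {x..y}" "\<forall>v\<in>{x..y}. f b \<le> f v"
      using continuous_attains_inf[OF _ _ c] xle by auto
    have *: "f w = f x" if "w \<in> {x<..<y}" "(\<forall>v\<in>{x<..<y}. f w \<le> f v) \<or> (\<forall>v\<in>{x<..<y}. f v \<le> f w)" for w
      using interior_extremum[of x y w] nz[of w] that \<open>x \<in> ?Z\<close> \<open>y \<in> ?Z\<close> by auto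
    have "f a = f x"
    proof (cases "a \<in> {x<..<y}")
      case True then show ?thesis using *[of a] a(2) by fastforce
    next
      case False then show ?thesis using a(1) fxy by force
    qed
    moreover have "f b = f x"
    proof (cases "b \<in> {x<..<y}")
      case True then show ?thesis using *[of b] b(2) by fastforce
    next
      case False then show ?thesis using b(1) fxy by force
    qed
    ultimately have const: "f v = f x" if "v \<in> {x..y}" for v
      using a(2) b(2) that by (metis order_antisym)
    have "openin (top_of_set {0..1}) (f ` {x<..<y})"
      using that by (intro open_image open_subset) auto
    moreover have "f ` {x<..<y} = {f x}"
    proof -
      have "(x+y)/2 \<in> {x<..<y}" using that by auto
      then have "f x \<in> f ` {x<..<y}" by (metis const greaterThanLessThan_subseteq_atLeastAtMost_iff image_eqI order_refl subsetD)
      moreover have "f v = f x" if "v \<in> {x<..<y}" for v using const[of v] that by simp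
      ultimately show ?thesis by auto
    qed
    ultimately have "openin (top_of_set {0..1}) {f x}" by simp
    then obtain e where e: "e > 0" "ball (f x) e \<inter> {0..1} \<subseteq> {f x}"
      unfolding openin_contains_ball by auto
    \<comment> \<open>A second point of the unit interval within \<open>e\<close> of its end
      \<open>f x\<close>.\<close>
    define g where "g = (if f x = 0 then min (e/2) 1 else max (1 - e/2) 0)"
    have "g \<in> ball (f x) e \<inter> {0..1}" "g \<noteq> f x"
      using e(1) \<open>x \<in> ?Z\<close> by (auto simp: g_def dist_real_def)
    then show False using e(2) by auto
  qed
  \<comment> \<open>Points at distance at least \<open>d\<close> fall into different cells of length
    \<open>d\<close>.\<close>
  have "inj_on (\<lambda>x. \<lfloor>x / d\<rfloor>) ?Z"
  proof (rule inj_onI, rule ccontr)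
    fix x y assume xy: "x \<in> ?Z" "y \<in> ?Z" "\<lfloor>x / d\<rfloor> = \<lfloor>y / d\<rfloor>" "x \<noteq> y"
    have "\<bar>x/d - y/d\<bar> < 1" using xy(3) by linarith
    moreover have "x/d - y/d = (x-y)/d" by (simp add: diff_divide_distrib)
    ultimately have "\<bar>x - y\<bar> < d" using d(1) by (simp add: abs_divide)
    then show False using sep[of x y] sep[of y x] xy by (cases "x < y") auto
  qed
  moreover have "(\<lambda>x. \<lfloor>x / d\<rfloor>) ` ?Z \<subseteq> {0..\<lfloor>1/d\<rfloor>}"
    using d(1) by (auto intro!: floor_mono divide_right_mono)
  ultimately show ?thesis by (meson finite_imageD finite_subset finite_atLeastAtMost_int)
qed

text \<open>Between consecutive turning points \<open>f\<close> is injective by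
  \<open>ends_differ\<close>, hence a homeomorphism onto the whole interval. The set is the image of
  \<open>C\<close> under the inverse acting on the first coordinate.\<close>

lemma connected_preimage_lap:
  fixes C :: "(real \<times> 'b::topological_space) set"
  assumes C: "connected C" "fst ` C \<subseteq> {0..1}"
    and xy: "0 \<le> x" "x < y" "y \<le> 1"
    and x: "f x = 0 \<or> f x = 1" and y: "f y = 0 \<or> f y = 1"
    and inside: "\<And>w. w \<in> {x<..<y} \<Longrightarrow> 0 < f w \<and> f w < 1"
  shows "connected {p. fst p \<in> {x..y} \<and> (f (fst p), snd p) \<in> C}" (is "connected ?D")
proof -
  have c: "continuous_on {x..y} f"
    using cont by (rule continuous_on_subset) (use xy in auto)
  have inj: "inj_on f {x..y}"
  proof -
    have *: "f u \<noteq> f v" if "u \<in> {x..y}" "v \<in> {x..y}" "u < v" for u v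
      using ends_differ[of u v] inside that xy by auto
    show ?thesis by (rule inj_onI) (metis * linorder_neq_iff)
  qed
  have fxy: "f x \<noteq> f y" using ends_differ[of x y] inside xy by auto
  have im: "f ` {x..y} = {0..1}"
  proof
    show "f ` {x..y} \<subseteq> {0..1}" using range01 xy by fastforce
    have "connected (f ` {x..y})" by (intro connected_continuous_image c) auto
    moreover have "f x \<in> f ` {x..y}" "f y \<in> f ` {x..y}" using xy by auto
    then have "0 \<in> f ` {x..y}" "1 \<in> f ` {x..y}" using fxy x y by metis+
    ultimately show "{0..1} \<subseteq> f ` {x..y}" by (meson connected_contains_Icc)
  qed
  obtain g where g: "homeomorphism {x..y} {0..1} f g"
    using homeomorphism_compact[OF compact_Icc c im inj] by blast
  have "connected ((\<lambda>p. (g (fst p), snd p)) ` C)"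
  proof (rule connected_continuous_image[OF _ C(1)])
    have "continuous_on C (g \<circ> fst)"
      using g C by (intro continuous_on_compose continuous_on_fst continuous_on_id)
         (auto intro: continuous_on_subset simp: homeomorphism_def)
    then show "continuous_on C (\<lambda>p. (g (fst p), snd p))"
      by (intro continuous_on_Pair continuous_on_snd continuous_on_id) (simp add: o_def)
  qed
  also have "(\<lambda>p. (g (fst p), snd p)) ` C = ?D"
  proof (intro equalityI subsetI)
    fix q assume "q \<in> (\<lambda>p. (g (fst p), snd p)) ` C"
    then obtain p where p: "p \<in> C" "q = (g (fst p), snd p)" by blast
    then have "fst p \<in> {0..1}" using C(2) by blast
    then have "g (fst p) \<in> {x..y}" "f (g (fst p)) = fst p"
      using g by (blast dest: homeomorphism_image2, meson homeomorphism_apply2)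
    then show "q \<in> ?D" using p by simp
  next
    fix q assume q: "q \<in> ?D"
    then have "g (f (fst q)) = fst q" using g by (simp add: homeomorphism_apply1)
    then show "q \<in> (\<lambda>p. (g (fst p), snd p)) ` C" using q
      by (intro image_eqI[of _ _ "(f (fst q), snd q)"]) simp_all
  qed
  finally show ?thesis .
qed

text \<open>The preimage consists of one copy of \<open>C\<close> over each lap of \<open>f\<close>; copies over adjacent laps
  meet above their common turning point because \<open>C\<close> reaches both ends of the interval.\<close>

lemma connected_preimage:
  fixes C :: "(real \<times> 'b::topological_space) set"
  assumes C: "connected C" "fst ` C = {0..1}"
  shows "connected {p. fst p \<in> {0..1} \<and> (f (fst p), snd p) \<in> C}"
proof -
  define Z where "Z = {x \<in> {0..1}. f x = 0 \<or> f x = 1}"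
  define D where "D x y = {p. fst p \<in> {x..y} \<and> (f (fst p), snd p) \<in> C}" for x y :: real
  have finZ: "finite Z" unfolding Z_def by (rule finite_turning_points)
  have ends: "0 \<in> Z" "1 \<in> Z" using end_values by (auto simp: Z_def)
  \<comment> \<open>Induction over the turning points from left to right: the lap from the preceding
    turning point \<open>p\<close> to \<open>z\<close> is attached to the part over
    \<open>{0..p}\<close>.\<close>
  have "connected (D 0 z)" if "z \<in> Z" "0 < z" for z
    using that
  proof (induction "card {w \<in> Z. w < z}" arbitrary: z rule: less_induct)
    case less
    have ne: "{w \<in> Z. w < z} \<noteq> {}" using ends(1) less.prems by blast
    define p where "p = Max {w \<in> Z. w < z}"
    have p: "p \<in> Z" "p < z" using Max_in[OF _ ne] finZ by (auto simp: p_def)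
    have between: "w \<notin> Z" if "p < w" "w < z" for w
    proof
      assume "w \<in> Z"
      then have "w \<le> p" unfolding p_def using that finZ by (intro Max_ge) auto
      then show False using that by simp
    qed
    have "{w \<in> Z. w < p} \<subset> {w \<in> Z. w < z}" using p by auto
    then have "card {w \<in> Z. w < p} < card {w \<in> Z. w < z}" using finZ by (simp add: psubset_card_mono)
    then have 1: "connected (D 0 p)" if "0 < p" using less.hyps p that by blast
    have 2: "connected (D p z)" unfolding D_def
    proof (rule connected_preimage_lap)
      fix w assume w: "w \<in> {p<..<z}"
      then have "w \<notin> Z" using between by auto
      moreover have "w \<in> {0..1}" using w p less.prems by (auto simp: Z_def)
      ultimately show "0 < f w \<and> f w < 1" using range01[of w] by (auto simp: Z_def)
    qed (use C p less.prems in \<open>auto simp: Z_def\<close>)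
    show ?case
    proof (cases "p = 0")
      case True
      then show ?thesis using 2 by simp
    next
      case False
      then have p0: "0 < p" using p by (auto simp: Z_def)
      obtain c where "(f p, c) \<in> C" using C(2) p(1) range01[of p] by (force simp: Z_def)
      then have "(p, c) \<in> D 0 p \<inter> D p z" using p p0 by (auto simp: D_def)
      then have "connected (D 0 p \<union> D p z)" using 1[OF p0] 2 by (intro connected_Un) auto
      also have "D 0 p \<union> D p z = D 0 z" using p p0 by (auto simp: D_def)
      finally show ?thesis .
    qed
  qed
  then show ?thesis using ends by (simp add: D_def)
qed

end

section \<open>Compact sets of sequences and their coordinate projections\<close>

text \<open>By coherence, agreement at level \<open>m\<close> gives agreement at all lower levels.
  If it occurred for arbitrarily large \<open>m\<close>, sequential compactness would produce limits
  in \<open>A\<close> and in \<open>B\<close> agreeing everywhere, a common point.\<close>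

lemma eventually_disjoint_projections:
  fixes A B :: "(nat \<Rightarrow> 'a::metric_space) set"
  assumes "compact A" "compact B" "A \<inter> B = {}"
    and coherent: "\<And>a b m. a \<in> A \<Longrightarrow> b \<in> B \<Longrightarrow> a (Suc m) = b (Suc m) \<Longrightarrow> a m = b m"
  shows "\<exists>N. \<forall>m\<ge>N. (\<lambda>z. z m) ` A \<inter> (\<lambda>z. z m) ` B = {}"
proof (rule ccontr)
  assume contr: "\<not> ?thesis"
  have "\<exists>a b. a \<in> A \<and> b \<in> B \<and> (\<forall>i\<le>N. a i = b i)" for N
  proof -
    obtain m a b where m: "m \<ge> N" "a \<in> A" "b \<in> B" "a m = b m"
      using contr by blast
    have "a i = b i" if "i \<le> m" for i
      using that by (induction rule: inc_induct) (use m coherent in auto)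
    then show ?thesis using m by (meson le_trans)
  qed
  then obtain a b where ab: "\<And>N. a N \<in> A" "\<And>N. b N \<in> B" "\<And>N i. i \<le> N \<Longrightarrow> a N i = b N i"
    by metis
  have "seq_compact (A \<times> B)"
    using assms by (intro compact_imp_seq_compact compact_Times)
  moreover have "\<forall>N. (a N, b N) \<in> A \<times> B" using ab by auto
  ultimately obtain l r where l: "l \<in> A \<times> B" and r: "strict_mono r"
    and lim: "((\<lambda>N. (a N, b N)) \<circ> r) \<longlonglongrightarrow> l"
    unfolding seq_compact_def by meson
  obtain la lb where lab: "l = (la, lb)" by (cases l)
  have coord: "(\<lambda>N. u N i) \<longlonglongrightarrow> v i" if "u \<longlonglongrightarrow> v" for u :: "nat \<Rightarrow> nat \<Rightarrow> 'a" and v i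
    using continuous_on_tendsto_compose[OF continuous_on_product_coordinates that] by simp
  have la: "(\<lambda>N. a (r N)) \<longlonglongrightarrow> la" and lb: "(\<lambda>N. b (r N)) \<longlonglongrightarrow> lb"
    using tendsto_fst[OF lim] tendsto_snd[OF lim] by (simp_all add: lab o_def)
  have "la i = lb i" for i
  proof (rule LIMSEQ_unique)
    show "(\<lambda>N. a (r N) i) \<longlonglongrightarrow> la i" using coord[OF la] .
    have "eventually (\<lambda>N. b (r N) i = a (r N) i) sequentially"
      using eventually_ge_at_top[of i]
      by eventually_elim (metis ab(3) r le_trans seq_suble)
    then show "(\<lambda>N. a (r N) i) \<longlonglongrightarrow> lb i" using coord[OF lb, of i] tendsto_cong by force
  qed
  then have "la = lb" by auto
  then show False using l lab assms(3) by auto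
qed

text \<open>A separation of \<open>X\<close> consists of two disjoint compact sets. Their
  projections are disjoint and closed from some level on, so they separate a projection of
  \<open>X\<close>.\<close>

lemma connected_if_projections_connected:
  fixes X :: "(nat \<Rightarrow> 'a::metric_space) set"
  assumes "compact X"
    and coherent: "\<And>a b m. a \<in> X \<Longrightarrow> b \<in> X \<Longrightarrow> a (Suc m) = b (Suc m) \<Longrightarrow> a m = b m"
    and conn: "\<And>m. m \<ge> N \<Longrightarrow> connected ((\<lambda>z. z m) ` X)"
  shows "connected X"
proof (rule ccontr)
  assume "\<not> connected X"
  then obtain A B where AB: "closed A" "closed B" "A \<noteq> {}" "B \<noteq> {}" "A \<union> B = X" "A \<inter> B = {}"
    using connected_closed_set[OF compact_imp_closed[OF assms(1)]] by auto
  have comp: "compact A" "compact B"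
    using AB assms(1) compact_Int_closed[of X A] compact_Int_closed[of X B] by (auto simp: Int_absorb1)
  obtain N' where N': "\<And>m. m \<ge> N' \<Longrightarrow> (\<lambda>z. z m) ` A \<inter> (\<lambda>z. z m) ` B = {}"
    using eventually_disjoint_projections[OF comp AB(6)] coherent AB(5) by blast
  define m where "m = max N N'"
  have cl: "closed ((\<lambda>z. z m) ` C)" if "compact C" for C :: "(nat \<Rightarrow> 'a) set"
    using that by (intro compact_imp_closed compact_continuous_image continuous_on_subset[OF continuous_on_product_coordinates]) auto
  have "connected ((\<lambda>z. z m) ` A \<union> (\<lambda>z. z m) ` B)"
    using conn[of m] AB(5) by (simp add: m_def image_Un[symmetric])
  then have "(\<lambda>z. z m) ` A = {} \<or> (\<lambda>z. z m) ` B = {}"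
    using cl comp N'[of m] connected_closed_set[of "(\<lambda>z. z m) ` A \<union> (\<lambda>z. z m) ` B"]
    by (metis closed_Un m_def max.cobounded2)
  then show False using AB by auto
qed

section \<open>Crossing paths in the plane\<close>

lemma path_component_vertical_translates:
  fixes K :: "(real \<times> real) set"
  assumes K: "path_connected K" "(x, t) \<in> K" "(x, t + r) \<in> K"
  shows "path_component (\<Union>j::int. (+) (0, of_int j * r) ` K) (x, t + of_int i * r) (x, t + of_int (i + int n) * r)"
    (is "path_component ?L _ _")
proof (induction n)
  case 0
  have "(x, t + of_int i * r) \<in> ?L"
    using K(2) by (auto intro!: exI[of _ i] image_eqI[of _ _ "(x,t)"])
  then show ?case by (simp add: path_component_refl)
next
  case (Suc n)
  \<comment> \<open>The next translate of \<open>K\<close> contains both points and so carries the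
    missing piece of the path.\<close>
  define K' where "K' = (+) (0, of_int (i + int n) * r) ` K"
  have "path_connected K'" unfolding K'_def using K(1) by (rule path_connected_translationI)
  moreover have "(x, t + of_int (i + int n) * r) \<in> K'" "(x, t + of_int (i + int (Suc n)) * r) \<in> K'"
    unfolding K'_def
    by (rule image_eqI[OF _ K(2)], simp, rule image_eqI[OF _ K(3)], simp add: algebra_simps)
  ultimately have "path_component K' (x, t + of_int (i + int n) * r) (x, t + of_int (i + int (Suc n)) * r)"
    by (simp add: path_connected_component)
  moreover have "K' \<subseteq> ?L" unfolding K'_def by blast
  ultimately show ?case using Suc path_component_trans path_component_of_subset by blast
qed

lemma path_meets_crossing_path:
  fixes g h :: "real \<Rightarrow> real \<times> real"
  assumes g: "path g" "path_image g \<subseteq> {a..b} \<times> {c..d}" "fst (pathstart g) = a" "fst (pathfinish g) = b"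
    and h: "path h" "path_image h \<subseteq> {a..b} \<times> {c..d}" "snd (pathstart h) = c" "snd (pathfinish h) = d"
  shows "path_image g \<inter> path_image h \<noteq> {}"
proof -
  \<comment> \<open>\<open>fashoda\<close> speaks about \<open>real^2\<close>; \<open>V\<close>
    carries the paths there.\<close>
  define V :: "real \<times> real \<Rightarrow> real^2" where "V p = (\<chi> i. if i = 1 then fst p else snd p)" for p
  have V: "V p $ 1 = fst p" "V p $ 2 = snd p" for p by (simp_all add: V_def)
  have inj: "V p = V q \<Longrightarrow> p = q" for p q
    by (metis V prod_eqI)
  have cV: "continuous_on S V" for S
    unfolding V_def
  proof (intro continuous_on_vec_lambda)
    show "continuous_on S (\<lambda>p. if i = 1 then fst p else snd p)" for i :: 2
      by (cases "i = 1") (simp_all add: continuous_on_fst continuous_on_snd)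
  qed
  have box: "V ` ({a..b} \<times> {c..d}) \<subseteq> cbox (V (a,c)) (V (b,d))"
    by (auto simp: mem_box_cart forall_2 V)
  obtain z where "z \<in> path_image (V \<circ> g)" "z \<in> path_image (V \<circ> h)"
  proof (rule fashoda[of "V \<circ> g" "V \<circ> h" "V (a,c)" "V (b,d)"])
    show "path (V \<circ> g)" "path (V \<circ> h)"
      using g(1) h(1) cV by (simp_all add: path_continuous_image)
    show "path_image (V \<circ> g) \<subseteq> cbox (V (a, c)) (V (b, d))" "path_image (V \<circ> h) \<subseteq> cbox (V (a, c)) (V (b, d))"
      using g(2) h(2) box unfolding path_image_compose by blast+
  qed (use g h in \<open>auto simp: pathstart_compose pathfinish_compose V\<close>)
  then show ?thesis using inj unfolding path_image_compose by blast
qed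

text \<open>A vertical shift of the curve runs from its leftmost to its rightmost abscissa, so by the Fashoda
  theorem it crosses the vertical line formed by the translates of the curve by multiples of \<open>r\<close>.\<close>

lemma periodic_curve_meets_translate:
  fixes \<gamma> :: "real \<Rightarrow> real \<times> real"
  assumes \<gamma>: "path \<gamma>" "pathstart \<gamma> = (x, t)" "pathfinish \<gamma> = (x, t + r)" and r: "r > 0"
  obtains p q and j :: int where "p \<in> path_image \<gamma>" "q \<in> path_image \<gamma>" "p + (0, s) = q + (0, of_int j * r)"
proof -
  define K where "K = path_image \<gamma>"
  have K: "compact K" "path_connected K" "(x, t) \<in> K" "(x, t + r) \<in> K"
    using \<gamma> pathstart_in_path_image[of \<gamma>] pathfinish_in_path_image[of \<gamma>]
    by (auto simp: K_def path_connected_path_image)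
  have cf: "continuous_on K fst" by (intro continuous_intros)
  obtain u where u: "u \<in> K" "\<And>p. p \<in> K \<Longrightarrow> fst u \<le> fst p"
    using continuous_attains_inf[OF K(1) _ cf] K(3) by blast
  obtain v where v: "v \<in> K" "\<And>p. p \<in> K \<Longrightarrow> fst p \<le> fst v"
    using continuous_attains_sup[OF K(1) _ cf] K(3) by blast
  have "bounded (snd ` K)" using K(1) by (intro compact_imp_bounded compact_continuous_image continuous_intros)
  then obtain B where B: "\<And>p. p \<in> K \<Longrightarrow> \<bar>snd p\<bar> \<le> B" unfolding bounded_iff by auto
  define L where "L = (\<Union>j::int. (+) (0, of_int j * r) ` K)"
  \<comment> \<open>So large that both ends of the path \<open>h0\<close> below lie outside the band
    of heights occupied by the curve shifted by \<open>s\<close>. The vertical segments added to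
    \<open>h0\<close> then cannot meet the shifted curve.\<close>
  obtain n :: nat where n: "real n * r > B + \<bar>s\<bar> + \<bar>t\<bar>"
    using reals_Archimedean3[OF r] by blast
  have "path_component L (x, t + of_int (- int n) * r) (x, t + of_int (- int n + int (2 * n)) * r)"
    unfolding L_def by (rule path_component_vertical_translates[OF K(2-4)])
  then obtain h0 where h0: "path h0" "path_image h0 \<subseteq> L" "pathstart h0 = (x, t - real n * r)" "pathfinish h0 = (x, t + real n * r)"
    unfolding path_component_def by auto
  have fstL: "fst p \<in> {fst u..fst v}" if "p \<in> L" for p
    using that u v by (auto simp: L_def)
  obtain g0 where g0: "path g0" "path_image g0 \<subseteq> K" "pathstart g0 = u" "pathfinish g0 = v"
    using K(2) u v unfolding path_connected_def by blast
  have "bounded (snd ` path_image h0)"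
    using h0(1) by (intro compact_imp_bounded compact_continuous_image continuous_intros compact_path_image)
  then obtain B0 where B0: "\<And>p. p \<in> path_image h0 \<Longrightarrow> \<bar>snd p\<bar> \<le> B0" unfolding bounded_iff by auto
  \<comment> \<open>Half the height of a rectangle that contains both \<open>h0\<close> and the
    shifted curve; \<open>h\<close> prolongs \<open>h0\<close> vertically to its bottom and
    top.\<close>
  define c where "c = max B0 (B + \<bar>s\<bar>)"
  define g where "g = (\<lambda>w. (0, s) + w) \<circ> g0"
  define h where "h = linepath (x, - c) (x, t - real n * r) +++ (h0 +++ linepath (x, t + real n * r) (x, c))"
  have B0': "\<bar>t - real n * r\<bar> \<le> B0" "\<bar>t + real n * r\<bar> \<le> B0"
    using B0[of "pathstart h0"] B0[of "pathfinish h0"] h0 pathstart_in_path_image[of h0] pathfinish_in_path_image[of h0] by auto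
  have xuv: "x \<in> {fst u..fst v}" using u v K(3) by fastforce
  have seg: "closed_segment (x, y) (x, z) \<subseteq> {x} \<times> closed_segment y z" for y z :: real
    by (auto simp: in_segment algebra_simps)
  have c: "B0 \<le> c" "B + \<bar>s\<bar> \<le> c" by (auto simp: c_def)
  have imh: "path_image h \<subseteq> {x} \<times> closed_segment (- c) (t - real n * r) \<union> (path_image h0 \<union> {x} \<times> closed_segment (t + real n * r) c)"
    unfolding h_def using h0 seg by (simp add: path_image_join) blast
  have img: "path_image g = (+) (0, s) ` path_image g0"
    by (simp add: g_def path_image_compose)
  have "path_image g \<inter> path_image h \<noteq> {}"
  proof (rule path_meets_crossing_path)
    show "path g" unfolding g_def using g0(1) by (intro path_continuous_image continuous_intros)
    show "path h" unfolding h_def using h0 by (simp add: path_join_imp)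
    show "path_image g \<subseteq> {fst u..fst v} \<times> {-c..c}"
    proof
      fix p assume "p \<in> path_image g"
      then obtain q where q: "q \<in> K" "p = (0,s) + q" using img g0(2) by auto
      then show "p \<in> {fst u..fst v} \<times> {-c..c}"
        using u(2)[of q] v(2)[of q] B[of q] c by (cases q) auto
    qed
    show "path_image h \<subseteq> {fst u..fst v} \<times> {-c..c}"
    proof
      fix p assume "p \<in> path_image h"
      then consider "fst p = x" "snd p \<in> closed_segment (- c) (t - real n * r)" | "p \<in> path_image h0"
        | "fst p = x" "snd p \<in> closed_segment (t + real n * r) c" using imh by fastforce
      then show "p \<in> {fst u..fst v} \<times> {-c..c}"
      proof cases
        case 1 then show ?thesis using xuv B0' c by (cases p) (auto simp: closed_segment_eq_real_ivl split: if_splits)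
      next
        case 2 then show ?thesis using h0(2) fstL[of p] B0[of p] c by (cases p) auto
      next
        case 3 then show ?thesis using xuv B0' c by (cases p) (auto simp: closed_segment_eq_real_ivl split: if_splits)
      qed
    qed
  qed (use g0 h0 in \<open>auto simp: g_def h_def pathstart_compose pathfinish_compose\<close>)
  then obtain w where w: "w \<in> path_image g" "w \<in> path_image h" by blast
  obtain p where p: "p \<in> K" "w = (0, s) + p" using w(1) img g0(2) by auto
  then have "\<bar>snd w\<bar> \<le> B + \<bar>s\<bar>" using B[of p] by (cases p) auto
  then have "w \<in> path_image h0"
    using subsetD[OF imh w(2)] n B0' c by (auto simp: closed_segment_eq_real_ivl split: if_splits)
  then obtain q and j::int where "q \<in> K" "w = (0, of_int j * r) + q"
    using h0(2) unfolding L_def by blast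
  then show thesis using that[of p q j] p by (simp add: K_def add.commute)
qed

section \<open>The strip as a covering of the annulus\<close>

definition strip :: "(real \<times> real) set" where
  "strip = {0..1} \<times> UNIV"

definition annulus :: "(real \<times> complex) set" where
  "annulus = {0..1} \<times> sphere 0 1"

text \<open>The factor \<open>2 * pi\<close> makes the deck transformations of this covering the
  vertical translations by integers.\<close>

definition wrap :: "real \<times> real \<Rightarrow> real \<times> complex" where
  "wrap p = (fst p, cis (2 * pi * snd p))"

text \<open>As \<open>j\<close> may be negative, this says that \<open>D\<close> is a union of full
  fibres of \<open>wrap\<close> and can be recovered from its image.\<close>

definition periodic :: "(real \<times> real) set \<Rightarrow> bool" where
  "periodic D \<longleftrightarrow> (\<forall>p\<in>D. \<forall>j::int. p + (0, of_int j) \<in> D)"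

lemma cis_2pi_eq_iff: "cis (2 * pi * s) = cis (2 * pi * t) \<longleftrightarrow> (\<exists>j::int. s = t + of_int j)"
proof -
  have "cis (2 * pi * s) = cis (2 * pi * t) \<longleftrightarrow> (\<exists>j::int. 2 * pi * s = 2 * pi * t + 2 * of_int j * pi)"
    unfolding cis_conv_exp exp_eq by (simp add: complex_eq_iff)
  also have "\<dots> \<longleftrightarrow> (\<exists>j::int. s = t + of_int j)"
    by (simp add: mult.commute[of _ pi] distrib_left[symmetric] flip: mult.assoc)
  finally show ?thesis .
qed

lemma unit_is_cis: "norm u = 1 \<Longrightarrow> \<exists>t. u = cis (2 * pi * t)"
  using cis_Arg[of u] by (intro exI[of _ "Arg u / (2 * pi)"]) (cases "u = 0", auto simp: sgn_div_norm)

lemma wrap_eq_iff: "wrap p = wrap q \<longleftrightarrow> (\<exists>j::int. p = q + (0, of_int j))"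
  by (auto simp: wrap_def cis_2pi_eq_iff prod_eq_iff)

lemma wrap_annulus: "p \<in> strip \<Longrightarrow> wrap p \<in> annulus"
  by (auto simp: wrap_def strip_def annulus_def)

lemma annulus_wrap: "q \<in> annulus \<Longrightarrow> \<exists>p\<in>strip. q = wrap p"
  using unit_is_cis[of "snd q"] by (auto simp: wrap_def strip_def annulus_def)

lemma continuous_on_wrap: "continuous_on S wrap"
  unfolding wrap_def by (intro continuous_intros)

lemma periodic_wrap_mem_iff:
  assumes "periodic D"
  shows "wrap p \<in> wrap ` D \<longleftrightarrow> p \<in> D"
  using assms unfolding periodic_def image_iff wrap_eq_iff by (metis wrap_eq_iff)

text \<open>Near \<open>wrap p\<close> the covering has a continuous section \<open>\<sigma>\<close>
  through \<open>p\<close>. The preimage of \<open>G\<close> under it is an open neighbourhood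
  contained in the image of \<open>G\<close>.\<close>

lemma wrap_open_map:
  assumes G: "openin (top_of_set strip) G"
  shows "openin (top_of_set annulus) (wrap ` G)"
proof (subst openin_subopen, intro ballI)
  fix q assume "q \<in> wrap ` G"
  then obtain p where p: "p \<in> G" "q = wrap p" by blast
  define u where "u = cis (2 * pi * snd p)"
  \<comment> \<open>The half of the annulus facing \<open>u\<close>: after rotation by
    \<open>cnj u\<close> it avoids the branch cut of \<open>Arg\<close>.\<close>
  define N where "N = annulus \<inter> {q. Re (snd q * cnj u) > 0}"
  define \<sigma> where "\<sigma> q = (fst q, snd p + Arg (snd q * cnj u) / (2 * pi))" for q :: "real \<times> complex"
  have u: "norm u = 1" "u * cnj u = 1" by (auto simp: u_def cis_cnj cis_mult)
  have "open {q :: real \<times> complex. Re (snd q * cnj u) > 0}"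
    by (intro open_Collect_less continuous_intros)
  then have N: "openin (top_of_set annulus) N" unfolding N_def by (rule openin_open_Int)
  have "continuous_on N (\<lambda>q. Arg (snd q * cnj u))"
  proof (intro continuous_on_compose2[OF continuous_on_Arg] continuous_intros)
    show "(\<lambda>q. snd q * cnj u) ` N \<subseteq> - \<real>\<^sub>\<le>\<^sub>0"
      by (auto simp: N_def complex_nonpos_Reals_iff)
  qed
  then have cont: "continuous_on N \<sigma>" unfolding \<sigma>_def
    by (intro continuous_on_Pair continuous_on_add continuous_on_divide continuous_on_fst continuous_on_const continuous_on_id) auto
  have "\<sigma> ` N \<subseteq> strip" by (auto simp: \<sigma>_def N_def annulus_def strip_def)
  then have 1: "openin (top_of_set annulus) (N \<inter> \<sigma> -` G)"
    using continuous_openin_preimage[OF cont _ G] openin_trans[OF _ N] by auto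
  have "p \<in> strip" using p(1) openin_imp_subset[OF G] by blast
  then have "q \<in> annulus" using p(2) wrap_annulus by blast
  moreover have q: "fst q = fst p" "snd q * cnj u = 1" using p(2) u by (simp_all add: wrap_def u_def)
  ultimately have 2: "q \<in> N \<inter> \<sigma> -` G"
    using p(1) unfolding N_def \<sigma>_def Int_iff vimage_eq mem_Collect_eq q by simp
  have "wrap (\<sigma> q') = q'" if "q' \<in> N" for q'
  proof -
    have "norm (snd q' * cnj u) = 1" using that u by (auto simp: N_def annulus_def norm_mult)
    then have "cis (Arg (snd q' * cnj u)) = snd q' * cnj u"
      by (metis cis_Arg div_by_1 norm_eq_zero of_real_1 sgn_eq zero_neq_one)
    then have "cis (2 * pi * snd (\<sigma> q')) = u * (snd q' * cnj u)"
      by (simp add: \<sigma>_def distrib_left cis_mult[symmetric] u_def)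
    also have "\<dots> = snd q'" using u by (simp add: algebra_simps)
    finally show ?thesis by (simp add: wrap_def \<sigma>_def)
  qed
  then have 3: "N \<inter> \<sigma> -` G \<subseteq> wrap ` G" by (metis IntE image_eqI subsetI vimageE)
  show "\<exists>T. openin (top_of_set annulus) T \<and> q \<in> T \<and> T \<subseteq> wrap ` G"
    using 1 2 3 by blast
qed

text \<open>The images of \<open>G\<close> and \<open>R\<close> are open in the annulus, so they
  would cut \<open>Q\<close> into two relatively open pieces.\<close>

lemma connected_in_wrap_image:
  assumes "connected Q" "openin (top_of_set strip) G" "openin (top_of_set strip) R"
    and "Q \<subseteq> wrap ` G \<union> wrap ` R" "wrap ` G \<inter> wrap ` R = {}" "Q \<inter> wrap ` G \<noteq> {}"
  shows "Q \<subseteq> wrap ` G"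
proof -
  have sub: "Q \<subseteq> annulus"
    using assms(2-4) wrap_annulus openin_imp_subset by fastforce
  have op: "openin (top_of_set Q) (Q \<inter> wrap ` X)" if X: "openin (top_of_set strip) X" for X
  proof -
    obtain T where "open T" "wrap ` X = annulus \<inter> T"
      using wrap_open_map[OF X] unfolding openin_open by blast
    then show ?thesis using sub unfolding openin_open by blast
  qed
  have "Q \<inter> wrap ` R = {}"
    using assms op[OF assms(2)] op[OF assms(3)] unfolding connected_openin by blast
  then show ?thesis using assms(4) by blast
qed

section \<open>Translates and components in the strip\<close>

lemma connected_component_translate:
  fixes p q d :: "'a::real_normed_vector"
  assumes "connected_component W p q" "\<And>w. w \<in> W \<Longrightarrow> d + w \<in> W"
  shows "connected_component W (d + p) (d + q)"
proof -
  obtain T where T: "connected T" "T \<subseteq> W" "p \<in> T" "q \<in> T"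
    using assms(1) unfolding connected_component_def by blast
  then have "connected ((+) d ` T)" by (intro connected_continuous_image continuous_intros)
  then show ?thesis unfolding connected_component_def using T assms(2) by blast
qed

text \<open>Consecutive translates of \<open>D\<close> share a translate of the point
  \<open>p + (0, 1)\<close>, so they form a chain in both directions.\<close>

lemma connected_integer_translates:
  fixes D :: "(real \<times> real) set"
  assumes D: "connected D" "p \<in> D" "p + (0, 1) \<in> D"
  shows "connected (\<Union>j::int. (+) (0, of_int j) ` D)" (is "connected ?E")
proof -
  have sub: "(+) (0, of_int j) ` D \<subseteq> ?E" for j :: int by blast
  have piece: "connected_component ?E ((0, of_int j) + v) ((0, of_int j) + w)" if "v \<in> D" "w \<in> D" for j :: int and v w
    unfolding connected_component_def
    using D(1) sub[of j] that by (intro exI[of _ "(+) (0, of_int j) ` D"] conjI connected_continuous_image continuous_intros) auto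
  have step: "connected_component ?E ((0, of_int j) + p) ((0, of_int (j + 1)) + p)" for j :: int
    using piece[OF D(2) D(3), of j] by (simp add: ac_simps)
  have base: "connected_component ?E p ((0, of_int j) + p)" for j :: int
  proof (induction j rule: int_induct[of _ 0])
    case base
    show ?case using piece[OF D(2) D(2), of 0] by (simp flip: zero_prod_def)
  next
    case (step1 i)
    then show ?case using connected_component_trans[OF step1(2) step[of i]] by blast
  next
    case (step2 i)
    have "connected_component ?E ((0, of_int (i - 1)) + p) ((0, of_int i) + p)"
      using step[of "i - 1"] by simp
    then show ?case
      using connected_component_trans[OF step2(2) connected_component_sym] by blast
  qed
  have "connected_component ?E p w" if w: "w \<in> ?E" for w
  proof -
    obtain j :: int and v where "v \<in> D" "w = (0, of_int j) + v" using w by blast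
    then show ?thesis using connected_component_trans[OF base piece[OF D(2)]] by blast
  qed
  then show ?thesis unfolding connected_iff_connected_component
    by (meson connected_component_trans connected_component_sym)
qed

text \<open>The points are joined one by one by arcs in \<open>G\<close>. This lets compact sets
  stand in for open ones, as the limit argument for connectedness works with compact sets.\<close>

lemma finite_subset_of_compact_connected:
  fixes G :: "'a::t2_space set"
  assumes G: "path_connected G" and F: "finite F" "F \<subseteq> G" "F \<noteq> {}"
  shows "\<exists>D. compact D \<and> connected D \<and> F \<subseteq> D \<and> D \<subseteq> G"
  using F(1,3,2)
proof (induction rule: finite_ne_induct)
  case (singleton x)
  then show ?case by (intro exI[of _ "{x}"]) auto
next
  case (insert x F)
  then obtain D where D: "compact D" "connected D" "F \<subseteq> D" "D \<subseteq> G" by auto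
  obtain y where y: "y \<in> F" using insert by auto
  obtain g where g: "path g" "path_image g \<subseteq> G" "pathstart g = x" "pathfinish g = y"
    using G insert.prems y unfolding path_connected_def by blast
  have "connected (D \<union> path_image g)"
    using D y g pathfinish_in_path_image[of g] by (intro connected_Un connected_path_image) auto
  then show ?case
    using D g pathstart_in_path_image[of g]
    by (intro exI[of _ "D \<union> path_image g"]) (auto simp: compact_path_image)
qed

lemma openin_strip_component:
  assumes W: "openin (top_of_set strip) W"
  shows "openin (top_of_set strip) (connected_component_set W p)"
proof -
  have "locally connected strip"
    by (intro convex_imp_locally_connected) (simp add: strip_def convex_Times)
  then have "locally connected W" using locally_open_subset W by blast
  then show ?thesis using openin_connected_component_locally_connected openin_trans W by blast
qed

lemma path_connected_open_strip:
  assumes "openin (top_of_set strip) G" "connected G"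
  shows "path_connected G"
proof -
  have "locally path_connected strip"
    by (intro convex_imp_locally_path_connected) (simp add: strip_def convex_Times)
  then have "locally path_connected G" using assms(1) locally_open_subset by blast
  then show ?thesis using assms(2)
    by (simp add: path_connected_component connected_iff_connected_component path_component_eq_connected_component)
qed

section \<open>Threads of annuli and pullbacks of periodic sets\<close>

locale knaster_solenoid =
  fixes f :: "nat \<Rightarrow> real \<Rightarrow> real" and n :: "nat \<Rightarrow> nat"
  assumes open_maps: "open_interval_map (f i)" and degrees: "n i \<ge> 2"
begin

definition threads :: "(nat \<Rightarrow> real \<times> complex) set" where
  "threads = {z. \<forall>i. z i \<in> annulus \<and> z i = (f i (fst (z (Suc i))), snd (z (Suc i)) ^ n i)}"

lemma threads_annulus: "z \<in> threads \<Longrightarrow> z i \<in> annulus"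
  unfolding threads_def by blast

lemma threads_step: "z \<in> threads \<Longrightarrow> z i = (f i (fst (z (Suc i))), snd (z (Suc i)) ^ n i)"
  unfolding threads_def by blast

lemma threads_coherent:
  "a \<in> threads \<Longrightarrow> b \<in> threads \<Longrightarrow> a (Suc m) = b (Suc m) \<Longrightarrow> a m = b m"
  using threads_step[of a m] threads_step[of b m] by metis

lemma compact_threads: "compact threads"
proof -
  have "compactin (product_topology (\<lambda>_::nat. euclidean) UNIV) (PiE UNIV (\<lambda>_. annulus))"
    unfolding compactin_PiE by (auto simp: annulus_def intro!: compact_Times)
  then have "compact (PiE UNIV (\<lambda>_::nat. annulus))" by (simp add: euclidean_product_topology)
  moreover have "closedin (top_of_set (PiE UNIV (\<lambda>_. annulus))) threads"
  proof -
    have "threads = (\<Inter>i. {z \<in> PiE UNIV (\<lambda>_. annulus). z i = (f i (fst (z (Suc i))), snd (z (Suc i)) ^ n i)})"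
      unfolding threads_def by (intro set_eqI) (simp add: PiE_iff, blast)
    moreover have "closedin (top_of_set (PiE UNIV (\<lambda>_. annulus)))
        {z \<in> PiE UNIV (\<lambda>_. annulus). z i = (f i (fst (z (Suc i))), snd (z (Suc i)) ^ n i)}" (is "closedin (top_of_set ?P) _") for i
    proof -
      have "continuous_on {0..1} (f i)" using open_maps open_interval_map.cont by blast
      then have "continuous_on ?P (\<lambda>z. (f i (fst (z (Suc i))), snd (z (Suc i)) ^ n i))"
        by (intro continuous_on_Pair continuous_on_power continuous_on_snd
            continuous_on_compose2[of "{0..1}" "f i" ?P "\<lambda>z. fst (z (Suc i))"] continuous_on_fst
            continuous_on_subset[OF continuous_on_product_coordinates]) (auto simp: annulus_def PiE_iff mem_Times_iff)
      then have "closedin (top_of_set ?P) {z \<in> ?P. dist (z i) (f i (fst (z (Suc i))), snd (z (Suc i)) ^ n i) = 0}"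
        by (intro continuous_closedin_preimage_constant continuous_on_dist continuous_on_subset[OF continuous_on_product_coordinates]) auto
      then show ?thesis by simp
    qed
    ultimately show ?thesis by (metis (no_types, lifting) closedin_INT UNIV_not_empty)
  qed
  ultimately show ?thesis using closedin_compact by blast
qed

lemma bonding_onto:
  assumes "q \<in> annulus"
  shows "\<exists>p\<in>annulus. (f i (fst p), snd p ^ n i) = q"
proof -
  have q: "fst q \<in> {0..1}" "norm (snd q) = 1" using assms by (auto simp: annulus_def)
  obtain x where x: "x \<in> {0..1}" "f i x = fst q"
    using q(1) open_interval_map.onto[OF open_maps, of i] by (metis imageE)
  obtain t where t: "snd q = cis (2 * pi * t)" using unit_is_cis[OF q(2)] by blast
  have "cis (2 * pi * t / n i) ^ n i = snd q"
    using degrees[of i] by (simp add: t Complex.DeMoivre)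
  then have "(f i (fst (x, cis (2 * pi * t / n i))), snd (x, cis (2 * pi * t / n i)) ^ n i) = q"
    using x(2) by simp
  moreover have "(x, cis (2 * pi * t / n i)) \<in> annulus" using x(1) by (simp add: annulus_def)
  ultimately show ?thesis by blast
qed

text \<open>Above level \<open>m\<close> preimages are chosen recursively, since the bonding maps
  are onto; below it the coordinates are forced.\<close>

lemma thread_through:
  assumes q: "q \<in> annulus"
  shows "\<exists>z\<in>threads. z m = q"
proof -
  define c where "c i q = (SOME p. p \<in> annulus \<and> (f i (fst p), snd p ^ n i) = q)" for i q
  have c: "c i q \<in> annulus \<and> (f i (fst (c i q)), snd (c i q) ^ n i) = q" if "q \<in> annulus" for i q
    unfolding c_def by (rule someI_ex) (use bonding_onto[OF that] in blast)
  define up where "up = rec_nat q (\<lambda>j. c (m + j))"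
  define down where "down = rec_nat q (\<lambda>j p. (f (m - Suc j) (fst p), snd p ^ n (m - Suc j)))"
  define z where "z i = (if i \<ge> m then up (i - m) else down (m - i))" for i
  have up: "up j \<in> annulus" for j by (induction j) (use q c in \<open>auto simp: up_def\<close>)
  have down: "down j \<in> annulus" for j
  proof (induction j)
    case 0 then show ?case using q by (simp add: down_def)
  next
    case (Suc j)
    then show ?case using open_interval_map.range01[OF open_maps]
      by (auto simp: down_def annulus_def norm_power mem_Times_iff)
  qed
  have "z i = (f i (fst (z (Suc i))), snd (z (Suc i)) ^ n i)" for i
  proof (cases "i \<ge> m")
    case True
    then have "up (Suc i - m) = c i (up (i - m))" by (simp add: up_def Suc_diff_le)
    then show ?thesis using True c[OF up] by (simp add: z_def)
  next
    case False
    define j where "j = m - Suc i"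
    have j: "m - i = Suc j" "m - Suc j = i" using False by (auto simp: j_def)
    have "z (Suc i) = down j"
      using False by (cases "Suc i = m") (auto simp: z_def j_def up_def down_def)
    then show ?thesis using False by (simp add: z_def j down_def)
  qed
  moreover have "z i \<in> annulus" for i using up down by (simp add: z_def)
  ultimately have "z \<in> threads" unfolding threads_def by blast
  moreover have "z m = q" by (simp add: z_def up_def)
  ultimately show ?thesis by blast
qed

text \<open>Stage \<open>j\<close> lies at level \<open>N + j\<close>. In the strip the power map
  lifts to multiplication by its degree, so each stage is a preimage under the lifted bonding
  map.\<close>

primrec pullback :: "nat \<Rightarrow> (real \<times> real) set \<Rightarrow> nat \<Rightarrow> (real \<times> real) set" where
  "pullback N D 0 = D"
| "pullback N D (Suc j) = {p. fst p \<in> {0..1} \<and> (f (N + j) (fst p), of_nat (n (N + j)) * snd p) \<in> pullback N D j}"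

text \<open>The three properties support each other along the induction: connectedness of the next
  stage uses \<open>connected_preimage\<close>, which requires the current one to project onto the
  interval. Periodicity survives because the degree is an integer.\<close>

lemma pullback_properties:
  assumes D: "connected D" "fst ` D = {0..1}" "periodic D"
  shows "connected (pullback N D j)" "fst ` pullback N D j = {0..1}" "periodic (pullback N D j)"
proof (induction j)
  case 0
  { case 1 then show ?case using D by simp }
  { case 2 then show ?case using D by simp }
  { case 3 then show ?case using D by simp }
next
  case (Suc j)
  define E where "E = pullback N D j"
  define k where "k = real (n (N + j))"
  have k: "k > 0" using degrees[of "N + j"] by (simp add: k_def)
  have E: "connected E" "fst ` E = {0..1}" "periodic E" using Suc by (auto simp: E_def)
  have S: "pullback N D (Suc j) = {p. fst p \<in> {0..1} \<and> (f (N + j) (fst p), k * snd p) \<in> E}"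
    by (simp add: E_def k_def)
  { case 1
    have "connected {p. fst p \<in> {0..1} \<and> (f (N + j) (fst p), snd p) \<in> E}" (is "connected ?R")
      using open_interval_map.connected_preimage[OF open_maps E(1,2)] .
    \<comment> \<open>Taking the preimage under the power map only rescales the second
      coordinate.\<close>
    then have "connected ((\<lambda>p. (fst p, snd p / k)) ` ?R)"
      by (intro connected_continuous_image continuous_intros) (use k in auto)
    also have "(\<lambda>p. (fst p, snd p / k)) ` ?R = pullback N D (Suc j)"
      unfolding S
    proof (intro equalityI subsetI)
      fix p assume "p \<in> {p. fst p \<in> {0..1} \<and> (f (N + j) (fst p), k * snd p) \<in> E}"
      then show "p \<in> (\<lambda>p. (fst p, snd p / k)) ` ?R"
        using k by (intro image_eqI[of _ _ "(fst p, k * snd p)"]) auto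
    qed (use k in auto)
    finally show ?case . }
  { case 2
    have "x \<in> fst ` pullback N D (Suc j)" if x: "x \<in> {0..1}" for x
    proof -
      have "f (N + j) x \<in> fst ` E" using x open_interval_map.range01[OF open_maps] E(2) by auto
      then obtain c where "(f (N + j) x, c) \<in> E" by force
      then have "(x, c / k) \<in> pullback N D (Suc j)" unfolding S using x k by simp
      then show ?thesis by (metis fst_conv imageI)
    qed
    moreover have "fst ` pullback N D (Suc j) \<subseteq> {0..1}" by auto
    ultimately show ?case by blast }
  { case 3
    have "(f (N + j) (fst p), k * (snd p + of_int i)) \<in> E" if "(f (N + j) (fst p), k * snd p) \<in> E" for p and i :: int
    proof -
      have "(f (N + j) (fst p), k * snd p) + (0, of_int (int (n (N + j)) * i)) \<in> E"
        using E(3) that unfolding periodic_def by blast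
      then show ?thesis by (simp add: k_def algebra_simps)
    qed
    then show ?case unfolding S periodic_def by auto }
qed

text \<open>By periodicity membership does not depend on the lift. A lift \<open>p\<close> of one
  coordinate is mapped by the lifted bonding map to a lift of the coordinate below.\<close>

lemma pullback_mem_iff:
  assumes D: "connected D" "fst ` D = {0..1}" "periodic D" and z: "z \<in> threads"
  shows "z (N + j) \<in> wrap ` pullback N D j \<longleftrightarrow> z N \<in> wrap ` D"
proof (induction j)
  case (Suc j)
  obtain p where p: "p \<in> strip" "z (N + Suc j) = wrap p"
    using annulus_wrap threads_annulus[OF z] by blast
  define k where "k = n (N + j)"
  have "z (N + j) = wrap (f (N + j) (fst p), real k * snd p)"
    using threads_step[OF z, of "N + j"] p(2) by (simp add: wrap_def k_def Complex.DeMoivre ac_simps)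
  then have "z (N + j) \<in> wrap ` pullback N D j \<longleftrightarrow> (f (N + j) (fst p), real k * snd p) \<in> pullback N D j"
    using pullback_properties(3)[OF D] periodic_wrap_mem_iff by metis
  also have "\<dots> \<longleftrightarrow> p \<in> pullback N D (Suc j)"
    using p(1) by (auto simp: k_def strip_def)
  also have "\<dots> \<longleftrightarrow> z (N + Suc j) \<in> wrap ` pullback N D (Suc j)"
    using pullback_properties(3)[OF D] periodic_wrap_mem_iff p(2) by metis
  finally show ?case using Suc by simp
qed simp

text \<open>At level \<open>N + j\<close> these threads project exactly onto the connected set
  \<open>wrap\<close> pullback N D j\<open>, and their set is compact because\<close>wrap
  \<open>D\<close> is closed.\<close>

lemma connected_threads_over:
  assumes D: "connected D" "fst ` D = {0..1}" "periodic D" and comp: "compact (wrap ` D)"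
  shows "connected {z \<in> threads. z N \<in> wrap ` D}" (is "connected ?X")
proof (rule connected_if_projections_connected)
  have "?X = threads \<inter> (\<lambda>z. z N) -` (wrap ` D)" by auto
  moreover have "closed ((\<lambda>z. z N) -` (wrap ` D))"
    by (intro closed_vimage compact_imp_closed comp continuous_on_product_coordinates)
  ultimately show "compact ?X" using compact_threads compact_Int_closed by metis
  show "a m = b m" if "a \<in> ?X" "b \<in> ?X" "a (Suc m) = b (Suc m)" for a b m
    using that threads_coherent by blast
  show "connected ((\<lambda>z. z m) ` ?X)" if "m \<ge> N" for m
  proof -
    define j where "j = m - N"
    have m: "m = N + j" using that by (simp add: j_def)
    have "(\<lambda>z. z m) ` ?X = wrap ` pullback N D j"
    proof (intro equalityI subsetI)
      fix q assume "q \<in> (\<lambda>z. z m) ` ?X"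
      then obtain z where "z \<in> threads" "z N \<in> wrap ` D" "q = z m" by blast
      then show "q \<in> wrap ` pullback N D j" using pullback_mem_iff[OF D, of z N j] m by simp
    next
      fix q assume q: "q \<in> wrap ` pullback N D j"
      then obtain p where p: "p \<in> pullback N D j" "q = wrap p" by blast
      then have "fst p \<in> {0..1}" using pullback_properties(2)[OF D, of N j] by blast
      then have "q \<in> annulus" using p(2) wrap_annulus[of p] by (simp add: strip_def mem_Times_iff)
      then obtain z where z: "z \<in> threads" "z m = q" using thread_through by blast
      then have "z \<in> ?X" using pullback_mem_iff[OF D z(1), of N j] q m by simp
      then show "q \<in> (\<lambda>z. z m) ` ?X" using z(2) by blast
    qed
    then show ?thesis
      using connected_continuous_image[OF continuous_on_wrap pullback_properties(1)[OF D]] by simp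
  qed
qed

text \<open>Any two such threads lie in a connected set of threads over a periodic \<open>E\<close>
  inside \<open>G\<close>, where \<open>E\<close> consists of the integer translates of a compact
  connected set.\<close>

lemma connected_threads_over_open:
  assumes G: "openin (top_of_set strip) G" "connected G" "periodic G" and ends: "{0, 1} \<subseteq> fst ` G"
  shows "connected {z \<in> threads. z N \<in> wrap ` G}" (is "connected ?V")
  unfolding connected_iff_connected_component
proof (intro ballI)
  fix v w assume v: "v \<in> ?V" and w: "w \<in> ?V"
  then obtain p q where p: "p \<in> G" "v N = wrap p" and q: "q \<in> G" "w N = wrap q" by auto
  obtain a b where ab: "(0, a) \<in> G" "(1, b) \<in> G" using ends by force
  have "p + (0, of_int 1) \<in> G" using G(3) p(1) unfolding periodic_def by blast
  then have p1: "p + (0, 1) \<in> G" by simp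
  have "path_connected G" using G(1,2) by (rule path_connected_open_strip)
  \<comment> \<open>\<open>p\<close> and \<open>q\<close> lie below the two threads, the side points
    make the translates of \<open>D\<close> project onto the interval, and \<open>p + (0, 1)\<close>
    links these translates.\<close>
  then obtain D where D: "compact D" "connected D" "{p, q, (0, a), (1, b), p + (0, 1)} \<subseteq> D" "D \<subseteq> G"
    using finite_subset_of_compact_connected[of G "{p, q, (0, a), (1, b), p + (0, 1)}"] p q ab p1 by auto
  define E where "E = (\<Union>j::int. (+) (0, of_int j) ` D)"
  have "connected E" unfolding E_def using D by (intro connected_integer_translates[of D p]) auto
  have perE: "periodic E"
  proof -
    have "(0, of_int i) + d + (0, of_int j) \<in> E" if "d \<in> D" for d and i j :: int
      unfolding E_def using that
      by (intro UN_I[of "i + j"] image_eqI[of _ _ d]) (auto simp: prod_eq_iff)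
    then show ?thesis unfolding periodic_def E_def by blast
  qed
  have "(0, of_int j) + d \<in> G" if "d \<in> D" for d and j :: int
    using D(4) G(3) that unfolding periodic_def by (metis add.commute subsetD)
  then have EG: "E \<subseteq> G" unfolding E_def by blast
  have DE: "D \<subseteq> E" unfolding E_def by (intro subsetI UN_I[of 0]) (auto simp flip: zero_prod_def)
  have fstE: "fst ` E = {0..1}"
  proof
    show "fst ` E \<subseteq> {0..1}" using EG openin_imp_subset[OF G(1)] by (auto simp: strip_def)
    have "connected (fst ` E)" using \<open>connected E\<close> by (intro connected_continuous_image continuous_intros)
    moreover have "0 \<in> fst ` E" "1 \<in> fst ` E" using D(3) DE by force+
    ultimately show "{0..1} \<subseteq> fst ` E" by (meson connected_contains_Icc)
  qed
  \<comment> \<open>\<open>E\<close> is unbounded, but its image is that of the compact set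
    \<open>D\<close>.\<close>
  have wrapE: "wrap ` E = wrap ` D"
  proof
    have "wrap ((0, of_int j) + d) = wrap d" for d and j :: int
      unfolding wrap_eq_iff by (intro exI[of _ j]) (simp add: prod_eq_iff)
    then show "wrap ` E \<subseteq> wrap ` D" unfolding E_def by auto
  qed (use DE in auto)
  have "compact (wrap ` E)" unfolding wrapE using D(1) continuous_on_wrap compact_continuous_image by blast
  then have "connected {z \<in> threads. z N \<in> wrap ` E}"
    using connected_threads_over[OF \<open>connected E\<close> fstE perE] by blast
  moreover have "{z \<in> threads. z N \<in> wrap ` E} \<subseteq> ?V" using EG by auto
  moreover have "v \<in> {z \<in> threads. z N \<in> wrap ` E}" "w \<in> {z \<in> threads. z N \<in> wrap ` E}"
    using v w p q D(3) DE by auto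
  ultimately show "connected_component ?V v w" unfolding connected_component_def by blast
qed

end

section \<open>Periodicity of the component lying over the continuum\<close>

lemma periodic_component_translate:
  assumes "periodic W" "connected_component W a b"
  shows "connected_component W (a + (0, of_int l)) (b + (0, of_int l))"
proof -
  have "(0, of_int l) + w \<in> W" if "w \<in> W" for w
    using assms(1) that unfolding periodic_def by (metis add.commute)
  then show ?thesis
    using connected_component_translate[OF assms(2), of "(0, of_int l)"] by (metis add.commute)
qed

text \<open>Integer translations permute the components of \<open>W\<close>. One that moves some
  point of \<open>G\<close> into \<open>G\<close> preserves \<open>G\<close>, and so do its
  multiples.\<close>

lemma component_stabilizer:
  assumes W: "periodic W" and G: "G = connected_component_set W p0"
    and p: "p \<in> G" "p + (0, of_int i) \<in> G" and q: "q \<in> G"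
  shows "q + (0, of_int (j * i)) \<in> G"
proof -
  note tr = periodic_component_translate[OF W]
  have "connected_component W q p" "connected_component W p (p + (0, of_int i))"
    using p q unfolding G by (metis connected_component_eq mem_Collect_eq)+
  moreover have "connected_component W (p + (0, of_int i)) (q + (0, of_int i))"
    using tr[OF connected_component_sym[OF \<open>connected_component W q p\<close>]] .
  ultimately have one: "connected_component W q (q + (0, of_int i))"
    by (meson connected_component_trans)
  have step: "connected_component W (q + (0, of_int (l * i))) (q + (0, of_int ((l + 1) * i)))" for l :: int
    using tr[OF one, where l="l * i"] by (simp add: algebra_simps)
  have "connected_component W q (q + (0, of_int (j * i)))"
  proof (induction j rule: int_induct[of _ 0])
    case base
    have "connected_component W q q" using one connected_component_in by (metis connected_component_refl)
    then show ?case by (simp flip: zero_prod_def)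
  next
    case (step1 l)
    then show ?case using connected_component_trans[OF step1(2) step[of l]] by blast
  next
    case (step2 l)
    have "connected_component W (q + (0, of_int ((l - 1) * i))) (q + (0, of_int (l * i)))"
      using step[of "l - 1"] by simp
    then show ?case using connected_component_trans[OF step2(2) connected_component_sym] by blast
  qed
  then show ?thesis using q unfolding G by (metis connected_component_trans mem_Collect_eq)
qed

text \<open>A path in \<open>G\<close> from \<open>p\<close> to its translate by \<open>r\<close>
  yields points \<open>a\<close>, \<open>b\<close> with \<open>a + 1\<close> equal to
  \<open>b\<close> shifted by a multiple of \<open>r\<close>. Such shifts preserve \<open>G\<close>,
  so \<open>G\<close> contains \<open>a\<close> and its unit translate.\<close>

lemma component_periodic:
  assumes W: "openin (top_of_set strip) W" "periodic W" and G: "G = connected_component_set W p0"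
    and p: "p \<in> G" "p + (0, of_int r) \<in> G" and r: "r > (0::int)"
  shows "periodic G"
proof -
  have "openin (top_of_set strip) G" unfolding G by (rule openin_strip_component[OF W(1)])
  then have "path_connected G" by (rule path_connected_open_strip) (simp add: G)
  then obtain \<gamma> where \<gamma>: "path \<gamma>" "path_image \<gamma> \<subseteq> G" "pathstart \<gamma> = p" "pathfinish \<gamma> = p + (0, of_int r)"
    using p unfolding path_connected_def by blast
  obtain a b and j :: int where ab: "a \<in> path_image \<gamma>" "b \<in> path_image \<gamma>" "a + (0, 1) = b + (0, of_int j * of_int r)"
  proof (rule periodic_curve_meets_translate[where \<gamma>=\<gamma> and x="fst p" and t="snd p" and r="of_int r" and s=1])
  qed (use \<gamma> r in \<open>auto simp: prod_eq_iff\<close>)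
  have "b + (0, of_int (j * r)) \<in> G"
    by (rule component_stabilizer[OF W(2) G p]) (use ab \<gamma> in auto)
  then have a: "a + (0, of_int 1) \<in> G" "a \<in> G" using ab \<gamma>(2) by auto
  show ?thesis
    unfolding periodic_def using component_stabilizer[OF W(2) G a(2,1)] by (metis mult.right_neutral)
qed

context knaster_solenoid
begin

lemma total_degree: "\<exists>k::nat. k \<ge> 2 ^ m \<and> (\<forall>z\<in>threads. snd (z N) = snd (z (N + m)) ^ k)"
proof (induction m)
  case (Suc m)
  then obtain k where k: "k \<ge> 2 ^ m" "\<And>z. z \<in> threads \<Longrightarrow> snd (z N) = snd (z (N + m)) ^ k" by blast
  have "snd (z N) = snd (z (N + Suc m)) ^ (n (N + m) * k)" if "z \<in> threads" for z
    using k(2)[OF that] threads_step[OF that, of "N + m"] by (simp add: power_mult)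
  moreover have "2 ^ Suc m \<le> n (N + m) * k"
    using mult_le_mono[OF degrees[of "N + m"] k(1)] by simp
  ultimately show ?case by blast
qed (auto intro: exI[of _ 1])

text \<open>Angles are measured at level \<open>N + m\<close> relative to \<open>z0\<close>, in full
  turns; \<open>L\<close> carries them to heights at level \<open>N\<close>. The points whose height
  falls into a translate of \<open>G\<close> by a multiple of \<open>k\<close> and the remaining
  ones cannot both occur over the connected set \<open>M\<close>. With \<open>m = 0\<close> and
  \<open>k = 1\<close> this places \<open>M\<close> over \<open>G\<close>.\<close>

lemma lift_to_component:
  assumes M: "connected M" "M \<subseteq> threads" and z0: "z0 \<in> M"
    and W: "openin (top_of_set strip) W" "periodic W" and MW: "(\<lambda>z. z N) ` M \<subseteq> wrap ` W"
    and p0: "z0 N = wrap p0" and G: "G = connected_component_set W p0"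
    and k: "k > (0::nat)" "\<And>z. z \<in> threads \<Longrightarrow> snd (z N) = snd (z (N + m)) ^ k"
    and z: "z \<in> M"
  shows "\<exists>t. snd (z (N + m)) = snd (z0 (N + m)) * cis (2 * pi * t) \<and> (fst (z N), k * t + snd p0) \<in> G"
proof -
  define u0 where "u0 = snd (z0 (N + m))"
  have u0: "norm u0 = 1" using threads_annulus z0 M(2) by (auto simp: u0_def annulus_def mem_Times_iff subset_iff)
  then have u0_nz: "u0 \<noteq> 0" by auto
  note op = openin_strip_component[OF W(1)]
  have Wstrip: "W \<subseteq> strip" using W(1) by (rule openin_imp_subset)
  \<comment> \<open>Only multiples of \<open>k\<close> are used, because one turn at level
    \<open>N + m\<close> is \<open>k\<close> turns at level \<open>N\<close>.\<close>
  define R where "R = {p \<in> W. \<forall>j::int. p + (0, of_int (int k * j)) \<notin> G}"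
  have "openin (top_of_set strip) R"
  proof (subst openin_subopen, intro ballI)
    fix p assume p: "p \<in> R"
    have "connected_component_set W p \<subseteq> R"
    proof
      fix q assume q: "q \<in> connected_component_set W p"
      have False if g: "q + (0, of_int (int k * j)) \<in> G" for j
      proof -
        have "connected_component W (q + (0, of_int (int k * j))) (p + (0, of_int (int k * j)))"
          using periodic_component_translate[OF W(2)] connected_component_sym q by blast
        then have "p + (0, of_int (int k * j)) \<in> G"
          using g unfolding G by (metis connected_component_trans mem_Collect_eq)
        then show False using p unfolding R_def by blast
      qed
      moreover have "q \<in> W" using q connected_component_in by blast
      ultimately show "q \<in> R" unfolding R_def by blast
    qed
    moreover have "p \<in> connected_component_set W p" using p by (simp add: R_def)
    ultimately show "\<exists>T. openin (top_of_set strip) T \<and> p \<in> T \<and> T \<subseteq> R" using op by blast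
  qed
  define L where "L p = (fst p, real k * snd p + snd p0)" for p :: "real \<times> real"
  have L: "continuous_on strip L" "L ` strip \<subseteq> strip"
    by (auto simp: L_def strip_def intro!: continuous_intros)
  have pre: "openin (top_of_set strip) (strip \<inter> L -` X)" if "openin (top_of_set strip) X" for X
    using continuous_openin_preimage[OF L(1)] L(2) that by blast
  \<comment> \<open>A mixed projection: the interval coordinate is read at level \<open>N\<close>,
    the circle coordinate at level \<open>N + m\<close>, rotated so that \<open>z0\<close> has angle
    zero.\<close>
  define Q where "Q = (\<lambda>z. (fst (z N), snd (z (N + m)) / u0)) ` M"
  have "Q \<subseteq> wrap ` (strip \<inter> L -` G)"
  proof (rule connected_in_wrap_image)
    show "openin (top_of_set strip) (strip \<inter> L -` G)" unfolding G by (rule pre[OF op])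
    show "openin (top_of_set strip) (strip \<inter> L -` R)" using pre \<open>openin (top_of_set strip) R\<close> .
    show "connected Q" unfolding Q_def
      using M(1) u0 by (intro connected_continuous_image continuous_on_Pair continuous_on_divide continuous_on_fst continuous_on_snd
          continuous_on_const continuous_on_subset[OF continuous_on_product_coordinates]) auto
    show "Q \<subseteq> wrap ` (strip \<inter> L -` G) \<union> wrap ` (strip \<inter> L -` R)"
    proof
      fix q assume "q \<in> Q"
      then obtain z where z: "z \<in> M" "q = (fst (z N), snd (z (N + m)) / u0)" by (auto simp: Q_def)
      have zt: "z \<in> threads" "z0 \<in> threads" using z z0 M(2) by auto
      have "q \<in> annulus" using threads_annulus[OF zt(1), of N] threads_annulus[OF zt(1), of "N + m"] u0
        unfolding z(2) by (auto simp: annulus_def mem_Times_iff norm_divide)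
      then obtain p where p: "p \<in> strip" "q = wrap p" using annulus_wrap by blast
      have "snd (z (N + m)) = u0 * cis (2 * pi * snd p)"
        using p(2) z(2) u0_nz by (simp add: wrap_def divide_eq_eq mult.commute)
      then have "snd (z N) = u0 ^ k * cis (2 * pi * snd p) ^ k"
        using k(2)[OF zt(1)] by (simp add: power_mult_distrib)
      also have "u0 ^ k = cis (2 * pi * snd p0)"
        using k(2)[OF zt(2)] p0 by (simp add: u0_def wrap_def)
      finally have "snd (z N) = cis (2 * pi * (real k * snd p + snd p0))"
        by (simp add: Complex.DeMoivre cis_mult algebra_simps)
      moreover have "fst (z N) = fst p" using p(2) z(2) by (simp add: wrap_def)
      ultimately have "z N = wrap (L p)" by (simp add: wrap_def L_def prod_eq_iff)
      then have LW: "L p \<in> W" using MW z(1) periodic_wrap_mem_iff[OF W(2)] by (metis image_subset_iff)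
      show "q \<in> wrap ` (strip \<inter> L -` G) \<union> wrap ` (strip \<inter> L -` R)"
      proof (cases "\<exists>j::int. L p + (0, of_int (int k * j)) \<in> G")
        case True
        then obtain j :: int where j: "L p + (0, of_int (int k * j)) \<in> G" by blast
        have "L (p + (0, of_int j)) = L p + (0, of_int (int k * j))"
          by (simp add: L_def algebra_simps)
        then have "p + (0, of_int j) \<in> strip \<inter> L -` G" using j p(1) by (auto simp: strip_def)
        moreover have "q = wrap (p + (0, of_int j))"
          unfolding p(2) wrap_eq_iff by (intro exI[of _ "- j"]) (simp add: prod_eq_iff)
        ultimately show ?thesis by blast
      next
        case False
        then have "L p \<in> R" using LW by (simp add: R_def)
        then show ?thesis using p by blast
      qed
    qed
    show "wrap ` (strip \<inter> L -` G) \<inter> wrap ` (strip \<inter> L -` R) = {}"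
    proof (rule ccontr)
      assume "\<not> ?thesis"
      then obtain p q where pq: "L p \<in> G" "L q \<in> R" "wrap p = wrap q" by blast
      then obtain j :: int where "p = q + (0, of_int j)" unfolding wrap_eq_iff by blast
      then have "L p = L q + (0, of_int (int k * j))" by (simp add: L_def algebra_simps)
      then show False using pq unfolding R_def by simp
    qed
    have p0W: "p0 \<in> W" using MW z0 p0 periodic_wrap_mem_iff[OF W(2)] by (metis image_subset_iff)
    then have "p0 \<in> strip" "p0 \<in> G" using Wstrip by (auto simp: G)
    then have "(fst p0, 0) \<in> strip \<inter> L -` G" by (simp add: L_def strip_def mem_Times_iff)
    moreover have "(fst (z0 N), snd (z0 (N + m)) / u0) = wrap (fst p0, 0)"
      using p0 u0 by (auto simp: wrap_def u0_def)
    ultimately show "Q \<inter> wrap ` (strip \<inter> L -` G) \<noteq> {}" using z0 unfolding Q_def by blast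
  qed
  then obtain p where "L p \<in> G" "(fst (z N), snd (z (N + m)) / u0) = wrap p"
    using z unfolding Q_def by blast
  then show ?thesis using u0_nz
    by (intro exI[of _ "snd p"]) (simp add: L_def wrap_def u0_def[symmetric] divide_eq_eq mult.commute)
qed

text \<open>If all integer translates of \<open>G\<close> were disjoint, the part of \<open>G\<close> lying over \<open>M\<close> would be bounded,
  and dividing by the degree \<open>k\<close> would confine the projection of \<open>M\<close> at a high level to a short arc
  around \<open>snd (z0 (N + m))\<close>.\<close>

lemma component_essential:
  assumes M: "compact M" "connected M" "M \<subseteq> threads" and z0: "z0 \<in> M"
    and onto: "\<And>m. (\<lambda>z. snd (z m)) ` M = sphere 0 1"
    and W: "openin (top_of_set strip) W" "periodic W" and MW: "(\<lambda>z. z N) ` M \<subseteq> wrap ` W"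
    and p0: "z0 N = wrap p0" and G: "G = connected_component_set W p0"
    and Gop: "openin (top_of_set strip) G"
  shows "\<exists>p (r::int). r > 0 \<and> p \<in> G \<and> p + (0, of_int r) \<in> G"
proof (rule ccontr)
  assume no: "\<not> ?thesis"
  have unique: "r = 0" if "p \<in> G" "p + (0, of_int r) \<in> G" for p and r :: int
  proof (rule ccontr)
    assume "r \<noteq> 0"
    then consider "r > 0" | "- r > 0" by linarith
    then show False
    proof cases
      case 1 then show False using no that by blast
    next
      case 2
      moreover have "p + (0, of_int r) + (0, of_int (- r)) = p" by (simp add: prod_eq_iff)
      ultimately show False using no that by metis
    qed
  qed
  have MG: "\<exists>j::int. p + (0, of_int j) \<in> G" if p: "wrap p \<in> (\<lambda>z. z N) ` M" for p
  proof -
    obtain z where z: "z \<in> M" "wrap p = z N" using p by auto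
    obtain t where t: "snd (z (N + 0)) = snd (z0 (N + 0)) * cis (2 * pi * t)" "(fst (z N), real 1 * t + snd p0) \<in> G"
      using lift_to_component[OF M(2,3) z0 W MW p0 G, of 1 0 z] z by auto
    have "z N = wrap (fst (z N), real 1 * t + snd p0)"
      using t(1) p0 by (simp add: wrap_def prod_eq_iff cis_mult distrib_left add.commute)
    then have "wrap (fst (z N), real 1 * t + snd p0) = wrap p" using z by simp
    then show ?thesis using t(2) unfolding wrap_eq_iff by metis
  qed
  \<comment> \<open>The part of the preimage of the projection of \<open>M\<close> in one
    fundamental domain; compactness lets finitely many translates of \<open>G\<close> cover
    it.\<close>
  define T where "T = ({0..1} \<times> {0..1}) \<inter> wrap -` ((\<lambda>z. z N) ` M)"
  have "compact ((\<lambda>z. z N) ` M)"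
    using M(1) by (intro compact_continuous_image continuous_on_subset[OF continuous_on_product_coordinates]) auto
  then have "closed (wrap -` ((\<lambda>z. z N) ` M))"
    by (intro closed_vimage compact_imp_closed continuous_on_wrap)
  then have compT: "compact T" unfolding T_def by (intro compact_Int_closed compact_Times) auto
  obtain G' where G': "open G'" "G = strip \<inter> G'" using Gop unfolding openin_open by blast
  define H where "H j = (\<lambda>p. p + (0, of_int j)) -` G'" for j :: int
  have "open (H j)" for j unfolding H_def using G'(1) by (intro open_vimage continuous_intros)
  moreover have "T \<subseteq> (\<Union>j\<in>UNIV. H j)"
    using MG unfolding T_def H_def G'(2) by blast
  ultimately obtain J where J: "finite J" "T \<subseteq> (\<Union>j\<in>J. H j)"
    using compactE_image[OF compT, of UNIV H] by metis
  \<comment> \<open>The element 0 keeps the maximum defined when \<open>J\<close> is empty; the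
    final 1 accounts for the fractional part of a height.\<close>
  define B where "B = real_of_int (Max ((\<lambda>j. \<bar>j\<bar>) ` J \<union> {0})) + 1"
  have bound: "\<bar>snd p\<bar> \<le> B" if p: "p \<in> G" "wrap p \<in> (\<lambda>z. z N) ` M" for p
  proof -
    \<comment> \<open>Shifting \<open>p\<close> down by \<open>i\<close> brings it into
      \<open>T\<close>, and shifting back up by some \<open>j\<close> from \<open>J\<close> returns
      it to \<open>G\<close>. Distinct translates being disjoint, \<open>i = j\<close>.\<close>
    define i where "i = \<lfloor>snd p\<rfloor>"
    define q where "q = p + (0, of_int (- i))"
    have "wrap q = wrap p" unfolding wrap_eq_iff q_def by blast
    moreover have "p \<in> strip" using p(1) G'(2) by blast
    moreover have "0 \<le> snd q" "snd q \<le> 1" by (simp_all add: q_def i_def) linarith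
    ultimately have "q \<in> T" using p(2) by (auto simp: T_def strip_def q_def mem_Times_iff)
    then obtain j where j: "j \<in> J" "q \<in> H j" using J by blast
    have "q + (0, of_int j) \<in> G" using j(2) \<open>p \<in> strip\<close> unfolding G'(2) H_def
      by (auto simp: strip_def q_def mem_Times_iff)
    moreover have "q + (0, of_int j) = p + (0, of_int (j - i))" by (simp add: q_def prod_eq_iff)
    ultimately have "i = j" using unique[OF p(1), of "j - i"] by simp
    then have "\<bar>i\<bar> \<in> (\<lambda>j. \<bar>j\<bar>) ` J \<union> {0}" using j(1) by blast
    then have "\<bar>i\<bar> \<le> Max ((\<lambda>j. \<bar>j\<bar>) ` J \<union> {0})" using J(1) by (intro Max_ge) auto
    then have "real_of_int \<bar>i\<bar> \<le> B - 1" unfolding B_def by linarith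
    then show ?thesis unfolding i_def by linarith
  qed
  \<comment> \<open>The degree \<open>k\<close> is at least \<open>2 ^ m\<close>, so half a turn at
    level \<open>N + m\<close> becomes a height beyond the bound \<open>B\<close>, even after the
    offset \<open>snd p0\<close>.\<close>
  obtain m :: nat where m: "2 * (B + \<bar>snd p0\<bar>) < 2 ^ m" using real_arch_pow[of 2] by force
  obtain k :: nat where k: "k \<ge> 2 ^ m" "\<And>z. z \<in> threads \<Longrightarrow> snd (z N) = snd (z (N + m)) ^ k"
    using total_degree[of m N] by blast
  have k0: "k > 0" using k(1) by (metis gr0I le_zero_eq power_not_zero zero_neq_numeral)
  define u0 where "u0 = snd (z0 (N + m))"
  have u0: "norm u0 = 1" using onto[of "N + m"] z0 by (auto simp: u0_def)
  \<comment> \<open>The antipode of \<open>u0\<close> is attained on \<open>M\<close>; its angle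
    \<open>t\<close> is a half-integer, so its absolute value is at least
    \<open>1/2\<close>.\<close>
  then have "- u0 \<in> (\<lambda>z. snd (z (N + m))) ` M" using onto[of "N + m"] by simp
  then obtain z where z: "z \<in> M" "snd (z (N + m)) = - u0" by auto
  obtain t where t: "- u0 = u0 * cis (2 * pi * t)" "(fst (z N), real k * t + snd p0) \<in> G"
    using lift_to_component[OF M(2,3) z0 W MW p0 G k0 k(2) z(1)] z(2) unfolding u0_def by auto
  have zt: "z \<in> threads" "z0 \<in> threads" using z z0 M(3) by auto
  have "u0 * cis (2 * pi * t) = u0 * cis (2 * pi * (1/2))" using t(1) by simp
  moreover have "u0 \<noteq> 0" using u0 by auto
  ultimately have "cis (2 * pi * t) = cis (2 * pi * (1/2))" using mult_left_cancel by blast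
  then obtain j :: int where j: "t = 1/2 + of_int j" unfolding cis_2pi_eq_iff by blast
  have "\<bar>t\<bar> \<ge> 1/2" unfolding j by (cases "j \<ge> 0") linarith+
  have "snd (z N) = (u0 * cis (2 * pi * t)) ^ k" using k(2)[OF zt(1)] z(2) t(1) by simp
  also have "\<dots> = snd (z0 N) * cis (2 * pi * t) ^ k" using k(2)[OF zt(2)] by (simp add: power_mult_distrib u0_def)
  also have "\<dots> = cis (2 * pi * (real k * t + snd p0))"
    using p0 by (simp add: wrap_def Complex.DeMoivre cis_mult algebra_simps)
  finally have "wrap (fst (z N), real k * t + snd p0) = z N" by (simp add: wrap_def prod_eq_iff)
  then have "\<bar>real k * t + snd p0\<bar> \<le> B" using bound[OF t(2)] z(1) by auto
  moreover have "real k * \<bar>t\<bar> = \<bar>real k * t\<bar>" by (simp add: abs_mult)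
  ultimately have "real k * \<bar>t\<bar> \<le> B + \<bar>snd p0\<bar>" by linarith
  moreover have "real k * (1/2) \<le> real k * \<bar>t\<bar>" using \<open>\<bar>t\<bar> \<ge> 1/2\<close> by (intro mult_left_mono) auto
  ultimately have "real k * (1/2) \<le> B + \<bar>snd p0\<bar>" by (rule order_trans[rotated])
  then have "real k \<le> 2 * (B + \<bar>snd p0\<bar>)" by simp
  moreover have "2 ^ m \<le> real k" using k(1) by (metis of_nat_le_iff of_nat_numeral of_nat_power)
  ultimately show False using m by (meson not_le order_trans)
qed

section \<open>Connected neighbourhoods in the space of threads\<close>

lemma threads_neighbourhood:
  assumes M: "compact M" "connected M" "M \<subseteq> threads" "M \<noteq> {}"
    and onto1: "\<And>m. (\<lambda>z. fst (z m)) ` M = {0..1}"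
    and onto2: "\<And>m. (\<lambda>z. snd (z m)) ` M = sphere 0 1"
    and U: "open U" "M \<subseteq> U"
  shows "\<exists>V. openin (top_of_set threads) V \<and> connected V \<and> M \<subseteq> V \<and> V \<subseteq> U"
proof -
  have "compact (threads - U)" using compact_threads U(1) by (simp add: compact_diff)
  then have "\<exists>N. \<forall>m\<ge>N. (\<lambda>z. z m) ` M \<inter> (\<lambda>z. z m) ` (threads - U) = {}"
    by (rule eventually_disjoint_projections[OF M(1)]) (use U(2) M(3) threads_coherent in auto)
  then obtain N where N: "(\<lambda>z. z N) ` M \<inter> (\<lambda>z. z N) ` (threads - U) = {}"
    by (meson order_refl)
  \<comment> \<open>A thread whose coordinate at level \<open>N\<close> lies in \<open>W0\<close>
    belongs to \<open>U\<close>.\<close>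
  define W0 where "W0 = - ((\<lambda>z. z N) ` (threads - U))"
  have "compact ((\<lambda>z. z N) ` (threads - U))"
    using \<open>compact (threads - U)\<close> by (intro compact_continuous_image continuous_on_subset[OF continuous_on_product_coordinates]) auto
  then have W0: "open W0" unfolding W0_def by (simp add: compact_imp_closed open_Compl)
  define W where "W = strip \<inter> wrap -` W0"
  have Wop: "openin (top_of_set strip) W"
    unfolding W_def by (intro openin_open_Int open_vimage W0 continuous_on_wrap)
  have Wper: "periodic W"
  proof -
    have "wrap (p + (0, of_int j)) = wrap p" for p and j :: int unfolding wrap_eq_iff by blast
    then show ?thesis unfolding periodic_def W_def by (auto simp: strip_def)
  qed
  have MW: "(\<lambda>z. z N) ` M \<subseteq> wrap ` W"
  proof
    fix q assume q: "q \<in> (\<lambda>z. z N) ` M"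
    then have "q \<in> annulus" using threads_annulus M(3) by blast
    then obtain p where "p \<in> strip" "q = wrap p" using annulus_wrap by blast
    then show "q \<in> wrap ` W" using q N unfolding W_def W0_def by blast
  qed
  obtain z0 where z0: "z0 \<in> M" using M(4) by blast
  obtain p0 where p0: "p0 \<in> W" "z0 N = wrap p0" using MW z0 by blast
  define G where "G = connected_component_set W p0"
  have Gop: "openin (top_of_set strip) G" unfolding G_def by (rule openin_strip_component[OF Wop])
  obtain p and r :: int where r: "r > 0" "p \<in> G" "p + (0, of_int r) \<in> G"
    using component_essential[OF M(1-3) z0 onto2 Wop Wper MW p0(2) G_def Gop] by blast
  have Gper: "periodic G" using component_periodic[OF Wop Wper G_def r(2,3,1)] .
  have MG: "z N \<in> wrap ` G" if z: "z \<in> M" for z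
  proof -
    obtain t where t: "snd (z (N + 0)) = snd (z0 (N + 0)) * cis (2 * pi * t)" "(fst (z N), real 1 * t + snd p0) \<in> G"
      using lift_to_component[OF M(2,3) z0 Wop Wper MW p0(2) G_def, of 1 0 z] z by auto
    have "z N = wrap (fst (z N), real 1 * t + snd p0)"
      using t(1) p0 by (simp add: wrap_def prod_eq_iff cis_mult distrib_left add.commute)
    then show ?thesis using t(2) by blast
  qed
  have ends: "{0, 1} \<subseteq> fst ` G"
  proof
    fix x :: real assume "x \<in> {0, 1}"
    then have "x \<in> (\<lambda>z. fst (z N)) ` M" using onto1[of N] by auto
    then obtain z where z: "z \<in> M" "fst (z N) = x" by auto
    then obtain g where "g \<in> G" "z N = wrap g" using MG by blast
    then show "x \<in> fst ` G" using z by (auto simp: wrap_def)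
  qed
  define V where "V = {z \<in> threads. z N \<in> wrap ` G}"
  have "connected V" unfolding V_def
    by (rule connected_threads_over_open[OF Gop _ Gper ends]) (simp add: G_def)
  moreover have "openin (top_of_set threads) V"
  proof -
    obtain O' where O': "open O'" "wrap ` G = annulus \<inter> O'" using wrap_open_map[OF Gop] unfolding openin_open by blast
    then have "V = threads \<inter> (\<lambda>z. z N) -` O'" using threads_annulus unfolding V_def by auto
    then show ?thesis using O'(1) by (simp add: openin_open_Int open_vimage continuous_on_product_coordinates)
  qed
  moreover have "M \<subseteq> V" using MG M(3) unfolding V_def by blast
  moreover have "V \<subseteq> U"
  proof
    fix z assume z: "z \<in> V"
    have "G \<subseteq> W" unfolding G_def by (rule connected_component_subset)
    then have "z N \<in> W0" using z unfolding V_def W_def by auto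
    then show "z \<in> U" using z unfolding V_def W0_def by blast
  qed
  ultimately show ?thesis by blast
qed

end

section \<open>Transfer to the product of the two continua\<close>

lemma continuous_map_into_inverse_limit:
  fixes A :: "'a::topological_space set"
  shows "continuous_map X (inverse_limit (\<lambda>_. top_of_set A) h) g \<longleftrightarrow>
    (\<forall>i. continuous_map X euclidean (\<lambda>x. g x i)) \<and>
    (\<forall>x\<in>topspace X. \<forall>i. g x i \<in> A \<and> g x i = h i (g x (Suc i)))"
  unfolding inverse_limit_def continuous_map_in_subtopology continuous_map_componentwise_UNIV
  by (auto simp: image_subset_iff Pi_iff)

lemma topspace_inverse_limit:
  "topspace (inverse_limit (\<lambda>_. top_of_set A) h) = {x. \<forall>i. x i \<in> A \<and> x i = h i (x (Suc i))}"
  unfolding inverse_limit_def by (auto simp: PiE_iff)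

text \<open>Pairing coordinates level by level identifies the product of the two inverse limits with
  the space of threads. This homeomorphism carries \<open>M\<close> and \<open>U\<close> there and
  the neighbourhood back.\<close>

lemma (in knaster_solenoid) fupcon_inverse_limits:
  fixes K :: "'a topology" and S :: "'b topology"
  assumes "K homeomorphic_space inverse_limit (\<lambda>_. top_of_set {0..1}) f"
    and "S homeomorphic_space inverse_limit (\<lambda>_. top_of_set (sphere 0 1)) (\<lambda>i z::complex. z ^ n i)"
  shows "fupcon K S"
proof -
  let ?I = "inverse_limit (\<lambda>_. top_of_set {0..1}) f"
  let ?C = "inverse_limit (\<lambda>_. top_of_set (sphere 0 1)) (\<lambda>i z::complex. z ^ n i)"
  let ?KS = "prod_topology K S"
  obtain \<phi> \<phi>' where \<phi>: "homeomorphic_maps K ?I \<phi> \<phi>'" using assms(1) unfolding homeomorphic_space_def by blast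
  obtain \<psi> \<psi>' where \<psi>: "homeomorphic_maps S ?C \<psi> \<psi>'" using assms(2) unfolding homeomorphic_space_def by blast
  define \<Phi> where "\<Phi> p i = (\<phi> (fst p) i, \<psi> (snd p) i)" for p and i :: nat
  define \<Psi> where "\<Psi> z = (\<phi>' (\<lambda>i. fst (z i)), \<psi>' (\<lambda>i. snd (z i)))" for z :: "nat \<Rightarrow> real \<times> complex"
  have \<phi>c: "continuous_map K ?I \<phi>" "continuous_map ?I K \<phi>'"
    and \<phi>i: "\<And>a. a \<in> topspace K \<Longrightarrow> \<phi>' (\<phi> a) = a" "\<And>x. x \<in> topspace ?I \<Longrightarrow> \<phi> (\<phi>' x) = x"
    using \<phi> unfolding homeomorphic_maps_def by auto
  have \<psi>c: "continuous_map S ?C \<psi>" "continuous_map ?C S \<psi>'"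
    and \<psi>i: "\<And>a. a \<in> topspace S \<Longrightarrow> \<psi>' (\<psi> a) = a" "\<And>x. x \<in> topspace ?C \<Longrightarrow> \<psi> (\<psi>' x) = x"
    using \<psi> unfolding homeomorphic_maps_def by auto
  have fst_thread: "(\<lambda>i. fst (z i)) \<in> topspace ?I" and snd_thread: "(\<lambda>i. snd (z i)) \<in> topspace ?C"
    if z: "z \<in> threads" for z
  proof -
    have "fst (z i) = f i (fst (z (Suc i)))" "snd (z i) = snd (z (Suc i)) ^ n i" for i
      using threads_step[OF z, of i] by (metis fst_conv, metis snd_conv)
    moreover have "fst (z i) \<in> {0..1}" "snd (z i) \<in> sphere 0 1" for i
      using threads_annulus[OF z, of i] unfolding annulus_def by (simp_all only: mem_Times_iff)
    ultimately show "(\<lambda>i. fst (z i)) \<in> topspace ?I" "(\<lambda>i. snd (z i)) \<in> topspace ?C"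
      unfolding topspace_inverse_limit by blast+
  qed
  have \<phi>t: "\<phi> a \<in> topspace ?I" if "a \<in> topspace K" for a
    using continuous_map_image_subset_topspace[OF \<phi>c(1)] that by blast
  have \<psi>t: "\<psi> b \<in> topspace ?C" if "b \<in> topspace S" for b
    using continuous_map_image_subset_topspace[OF \<psi>c(1)] that by blast
  have \<Phi>t: "\<Phi> p \<in> threads" if p: "p \<in> topspace ?KS" for p
  proof -
    have "fst p \<in> topspace K" "snd p \<in> topspace S" using p by (auto simp: mem_Times_iff)
    then have "\<phi> (fst p) \<in> topspace ?I" "\<psi> (snd p) \<in> topspace ?C" using \<phi>t \<psi>t by auto
    then have "\<phi> (fst p) i \<in> {0..1}" "\<phi> (fst p) i = f i (\<phi> (fst p) (Suc i))"
      "\<psi> (snd p) i \<in> sphere 0 1" "\<psi> (snd p) i = \<psi> (snd p) (Suc i) ^ n i" for i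
      unfolding topspace_inverse_limit by blast+
    then have "\<Phi> p i \<in> annulus \<and> \<Phi> p i = (f i (fst (\<Phi> p (Suc i))), snd (\<Phi> p (Suc i)) ^ n i)" for i
      unfolding \<Phi>_def annulus_def fst_conv snd_conv by (intro conjI SigmaI arg_cong2[of _ _ _ _ Pair])
    then show ?thesis unfolding threads_def by blast
  qed
  have \<Phi>c: "continuous_map ?KS (top_of_set threads) \<Phi>"
  proof -
    have "continuous_map ?KS euclidean (\<lambda>p. \<Phi> p i)" for i
    proof -
      have 1: "continuous_map K euclidean (\<lambda>a. \<phi> a i)" and 2: "continuous_map S euclidean (\<lambda>b. \<psi> b i)"
        using \<phi>c(1) \<psi>c(1) unfolding continuous_map_into_inverse_limit by auto
      have "continuous_map ?KS euclidean (\<lambda>p. \<phi> (fst p) i)" "continuous_map ?KS euclidean (\<lambda>p. \<psi> (snd p) i)"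
        using continuous_map_compose[OF continuous_map_fst 1] continuous_map_compose[OF continuous_map_snd 2]
        by (simp_all add: o_def)
      then show ?thesis unfolding \<Phi>_def
        by (subst prod_topology_euclidean[symmetric]) (rule continuous_map_pairedI)
    qed
    then have "continuous_map ?KS euclidean \<Phi>"
      by (simp add: continuous_map_componentwise_UNIV flip: euclidean_product_topology)
    then show ?thesis using \<Phi>t by (simp add: continuous_map_in_subtopology image_subset_iff)
  qed
  have fst_cont: "continuous_map (top_of_set threads) euclidean (\<lambda>z. fst (z i))"
    and snd_cont: "continuous_map (top_of_set threads) euclidean (\<lambda>z. snd (z i))" for i
    by (simp_all add: continuous_on_fst continuous_on_snd continuous_on_subset[OF continuous_on_product_coordinates])
  have \<Psi>c: "continuous_map (top_of_set threads) ?KS \<Psi>"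
  proof -
    have "continuous_map (top_of_set threads) ?I (\<lambda>z i. fst (z i))"
      unfolding continuous_map_into_inverse_limit topspace_euclidean_subtopology
      using fst_cont fst_thread[unfolded topspace_inverse_limit mem_Collect_eq] by blast
    moreover have "continuous_map (top_of_set threads) ?C (\<lambda>z i. snd (z i))"
      unfolding continuous_map_into_inverse_limit topspace_euclidean_subtopology
      using snd_cont snd_thread[unfolded topspace_inverse_limit mem_Collect_eq] by blast
    ultimately have "continuous_map (top_of_set threads) K (\<phi>' \<circ> (\<lambda>z i. fst (z i)))"
      "continuous_map (top_of_set threads) S (\<psi>' \<circ> (\<lambda>z i. snd (z i)))"
      using \<phi>c(2) \<psi>c(2) continuous_map_compose by blast+
    then show ?thesis unfolding \<Psi>_def o_def by (rule continuous_map_pairedI)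
  qed
  have \<Psi>\<Phi>: "\<Psi> (\<Phi> p) = p" if "p \<in> topspace ?KS" for p
    using that \<phi>i(1) \<psi>i(1) by (auto simp: \<Psi>_def \<Phi>_def)
  have \<Phi>\<Psi>: "\<Phi> (\<Psi> z) = z" if "z \<in> threads" for z
    using \<phi>i(2)[OF fst_thread[OF that]] \<psi>i(2)[OF snd_thread[OF that]] by (simp add: \<Psi>_def \<Phi>_def fun_eq_iff)
  have homeo: "homeomorphic_maps ?KS (top_of_set threads) \<Phi> \<Psi>"
    unfolding homeomorphic_maps_def using \<Phi>c \<Psi>c \<Psi>\<Phi> \<Phi>\<Psi> by simp
  have opens: "open_map ?KS (top_of_set threads) \<Phi>" "open_map (top_of_set threads) ?KS \<Psi>"
    using homeo unfolding homeomorphic_maps_map by (simp_all add: homeomorphic_imp_open_map)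
  \<comment> \<open>Each coordinate map is onto because a thread passes through every point of every
    level; the circle coordinate 1 is an arbitrary choice.\<close>
  have \<Phi>\<Psi>_fst: "x \<in> (\<lambda>a. \<phi> a m) ` topspace K" if "x \<in> {0..1}" for x m
  proof -
    obtain z where z: "z \<in> threads" "z m = (x, 1)" using thread_through[of "(x, 1)" m] \<open>x \<in> {0..1}\<close> by (auto simp: annulus_def)
    then have "\<Psi> z \<in> topspace ?KS" using continuous_map_image_subset_topspace[OF \<Psi>c] by auto
    moreover have "\<phi> (fst (\<Psi> z)) m = x" using \<Phi>\<Psi>[OF z(1)] z(2) unfolding \<Phi>_def by (metis fst_conv)
    ultimately show ?thesis by (auto simp: mem_Times_iff)
  qed
  have \<Phi>\<Psi>_snd: "u \<in> (\<lambda>b. \<psi> b m) ` topspace S" if "u \<in> sphere 0 1" for u m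
  proof -
    obtain z where z: "z \<in> threads" "z m = (0, u)" using thread_through[of "(0, u)" m] \<open>u \<in> sphere 0 1\<close> by (auto simp: annulus_def)
    then have "\<Psi> z \<in> topspace ?KS" using continuous_map_image_subset_topspace[OF \<Psi>c] by auto
    moreover have "\<psi> (snd (\<Psi> z)) m = u" using \<Phi>\<Psi>[OF z(1)] z(2) unfolding \<Phi>_def by (metis snd_conv)
    ultimately show ?thesis by (auto simp: mem_Times_iff)
  qed
  show ?thesis
    unfolding fupcon_def
  proof (intro allI impI, elim conjE)
    fix M U
    assume M: "M \<subseteq> topspace ?KS" "M \<noteq> {}" "compactin ?KS M" "connectedin ?KS M"
      "fst ` M = topspace K" "snd ` M = topspace S" and U: "openin ?KS U" "M \<subseteq> U"
    have cM: "compact (\<Phi> ` M)" "connected (\<Phi> ` M)"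
      using image_compactin[OF M(3) \<Phi>c] connectedin_continuous_map_image[OF \<Phi>c M(4)]
      by (simp_all add: compactin_subtopology connectedin_subtopology)
    have "openin (top_of_set threads) (\<Phi> ` U)"
      using opens(1) U(1) by (simp add: open_map_def)
    then obtain U' where U': "open U'" "\<Phi> ` U = threads \<inter> U'" unfolding openin_open by blast
    have on1: "(\<lambda>z. fst (z m)) ` (\<Phi> ` M) = {0..1}" for m
    proof -
      have "(\<lambda>z. fst (z m)) ` (\<Phi> ` M) = (\<lambda>a. \<phi> a m) ` (fst ` M)" by (simp add: image_image \<Phi>_def)
      also have "\<dots> = {0..1}" unfolding M(5) using \<phi>t \<Phi>\<Psi>_fst unfolding topspace_inverse_limit by blast
      finally show ?thesis .
    qed
    have on2: "(\<lambda>z. snd (z m)) ` (\<Phi> ` M) = sphere 0 1" for m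
    proof -
      have "(\<lambda>z. snd (z m)) ` (\<Phi> ` M) = (\<lambda>b. \<psi> b m) ` (snd ` M)" by (simp add: image_image \<Phi>_def)
      also have "\<dots> = sphere 0 1" unfolding M(6) using \<psi>t \<Phi>\<Psi>_snd unfolding topspace_inverse_limit by blast
      finally show ?thesis .
    qed
    have "\<Phi> ` M \<subseteq> threads" "\<Phi> ` M \<noteq> {}" "\<Phi> ` M \<subseteq> U'" using \<Phi>t M(1,2) U(2) U'(2) by blast+
    then obtain V where V: "openin (top_of_set threads) V" "connected V" "\<Phi> ` M \<subseteq> V" "V \<subseteq> U'"
      using threads_neighbourhood[OF cM _ _ on1 on2 U'(1)] by blast
    have Vt: "V \<subseteq> threads" using V(1) openin_imp_subset by blast
    have "openin ?KS (\<Psi> ` V)"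
      using opens(2) V(1) by (simp add: open_map_def)
    moreover have "connectedin ?KS (\<Psi> ` V)"
      using connectedin_continuous_map_image[OF \<Psi>c] V(2) Vt by (simp add: connectedin_subtopology)
    moreover have "M \<subseteq> \<Psi> ` V"
    proof
      fix p assume p: "p \<in> M"
      then have "\<Psi> (\<Phi> p) = p" using M(1) by (intro \<Psi>\<Phi>) blast
      then show "p \<in> \<Psi> ` V" using V(3) p by (metis image_eqI image_subset_iff)
    qed
    moreover have "\<Psi> ` V \<subseteq> U"
    proof
      fix p assume "p \<in> \<Psi> ` V"
      then obtain z where z: "z \<in> V" "p = \<Psi> z" by blast
      then have "z \<in> \<Phi> ` U" using U'(2) V(4) Vt by blast
      then obtain q where "q \<in> U" "z = \<Phi> q" by blast
      then show "p \<in> U" using z(2) \<Psi>\<Phi> openin_subset[OF U(1)] by (metis subsetD)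
    qed
    ultimately show "\<exists>V. openin ?KS V \<and> connectedin ?KS V \<and> M \<subseteq> V \<and> V \<subseteq> U" by blast
  qed
qed

theorem theorem2:
  fixes K :: "'a topology" and S :: "'b topology"
  assumes "solenoid S" and "knaster_continuum K"
  shows "fupcon K S"
proof -
  obtain n :: "nat \<Rightarrow> nat" where n: "\<And>i. n i \<ge> 2"
    and S: "S homeomorphic_space inverse_limit (\<lambda>_. unit_circle) (\<lambda>i z. z ^ n i)"
    using assms(1) unfolding solenoid_def by blast
  obtain f :: "nat \<Rightarrow> real \<Rightarrow> real" where f: "\<And>i. continuous_map unit_interval unit_interval (f i)"
      "\<And>i. open_map unit_interval unit_interval (f i)" "\<And>i. f i ` {0..1} = {0..1}"
    and K: "K homeomorphic_space inverse_limit (\<lambda>_. unit_interval) f"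
    using assms(2) unfolding knaster_continuum_def by blast
  interpret knaster_solenoid f n
  proof
    fix i
    show "continuous_on {0..1} (f i)" using f(1)[of i] by (simp add: unit_interval_def)
    show "f i ` {0..1} = {0..1}" by (rule f(3))
    show "openin (top_of_set {0..1}) (f i ` U)" if "openin (top_of_set {0..1}) U" for U
      using f(2)[of i] that unfolding open_map_def unit_interval_def by blast
    show "2 \<le> n i" by (rule n)
  qed
  show ?thesis
    using fupcon_inverse_limits K S unfolding unit_interval_def unit_circle_def by blast
qed

end
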